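(* Let $1\le p<\infty$ and let $\mu:\mathbb{R}\to\mathbb{R}$ be a function such that: $\mu(t)\ge1$ for $t\in\mathbb{R}$; $\mu$ is even and monotonically nondecreasing for $t>0$; $\mu(t+s)\le\mu(t)\mu(s)$ for all $s,t\in\mathbb{R}$; and $\int_{-\infty}^{\infty}\frac{\ln\mu(t)}{1+t^2}\,dt<\infty$. Then for all $n\in\mathbb{N}$ there exist constants $c_n>0$ such that for every $\sigma\ge1$ and every $f\in L_p(\mathbb{R},\mu^p)\cap B_\sigma$, $$\|f^{(n)}\|_{L_p(\mathbb{R},\mu^p)}\le c_n\sigma^n\|f\|_{L_p(\mathbb{R},\mu^p)}.$$ (The constants $c_n$ do not depend on $\sigma$ and on $f$.)
   Context: $L_p(\mathbb{R},\mu^p)$ is the Banach space of (complex-valued, measurable) functions $f$ on $\mathbb{R}$ with $\|f\|^p_{L_p(\mathbb{R},\mu^p)}=\int_{-\infty}^{\infty}|f(s)|^p\mu^p(s)\,ds<\infty$. $B_\sigma$ denotes the set of (restrictions to $\mathbb{R}$ of) entire functions of exponential type $\sigma$, i.e. entire $f$ such that for every $\epsilon>0$ there is $C_\epsilon>0$ with $|f(z)|\le C_\epsilon e^{(\sigma+\epsilon)|z|}$ for all $z\in\mathbb{C}$. *)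

theory Defs
  imports "HOL-Analysis.Analysis"
begin

definition Lp_weighted :: "real \<Rightarrow> (real \<Rightarrow> real) \<Rightarrow> (real \<Rightarrow> complex) set" where
  "Lp_weighted p \<mu> = {f. f \<in> borel_measurable lebesgue \<and>
     integrable lebesgue (\<lambda>s. norm (f s) powr p * \<mu> s powr p)}"

(* Meaningful on members of Lp_weighted only: the Bochner integral is 0 otherwise. *)
definition Lp_weighted_norm :: "real \<Rightarrow> (real \<Rightarrow> real) \<Rightarrow> (real \<Rightarrow> complex) \<Rightarrow> real" where
  "Lp_weighted_norm p \<mu> f =
     (LINT s|lebesgue. norm (f s) powr p * \<mu> s powr p) powr (1 / p)"

definition exponential_type :: "real \<Rightarrow> (complex \<Rightarrow> complex) \<Rightarrow> bool" where
  "exponential_type \<sigma> F \<longleftrightarrow> F holomorphic_on UNIV \<and>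
     (\<forall>\<epsilon>>0. \<exists>C>0. \<forall>z. norm (F z) \<le> C * exp ((\<sigma> + \<epsilon>) * norm z))"

definition B_type :: "real \<Rightarrow> (real \<Rightarrow> complex) set" where
  "B_type \<sigma> = {f. \<exists>F. exponential_type \<sigma> F \<and> f = (\<lambda>x. F (complex_of_real x))}"

definition nth_derivative :: "nat \<Rightarrow> (real \<Rightarrow> complex) \<Rightarrow> real \<Rightarrow> complex" where
  "nth_derivative n = (\<lambda>f t. vector_derivative f (at t)) ^^ n"

end

theory Submission
  imports Defs "HOL-Complex_Analysis.Complex_Analysis"
begin

text \<open>By Cauchy's estimate, differentiation preserves \<open>B_type \<sigma>\<close>, so it is enough to bound one derivative by a
constant times \<open>\<sigma>\<close> and to iterate. For a single derivative the plan is to express \<open>f' x\<close> through the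
values of \<open>f\<close> at translates \<open>x + t\<close>, with coefficients that beat \<open>\<mu> t\<close>: translation by \<open>t\<close> costs at most
a factor \<open>\<mu> t\<close> in the weighted norm, since \<open>\<mu> x \<le> \<mu> (x + t) * \<mu> t\<close>.

The expression comes from an interpolation formula in the manner of M. Riesz. If \<open>G\<close> is entire of small
exponential type and bounded on the real line, then summing the residues of
\<open>G z / (z\<^sup>2 * cos z)\<close> over growing circles gives \<open>deriv G 0\<close> as a series in the values of \<open>G\<close> at the zeros
of the cosine, with coefficients of size \<open>1 / (node j)\<^sup>2\<close> (lemma \<open>norm_deriv_le_node_sum\<close>). The
contour integrals tend to \<open>0\<close> because \<open>G\<close> grows no faster than \<open>exp \<bar>Im z\<bar>\<close>, which is a
Phragmen-Lindelof principle (lemma \<open>phragmen_lindelof_real_line\<close>).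

Applied to \<open>f (x + z)\<close> itself, this would need \<open>\<mu>\<close> to be summable against \<open>1 / (node j)\<^sup>2\<close>. It is applied
instead to \<open>G z = f (x + z) * h (\<sigma> * z)\<close>, where \<open>h\<close> is even, entire of finite exponential type,
\<open>h 0 = 1\<close>, and \<open>\<bar>h x\<bar> \<le> \<mu> 1 / \<mu> x\<close> for real \<open>x \<noteq> 0\<close>. Evenness makes \<open>deriv h 0 = 0\<close>, so
\<open>deriv G 0 = f' x\<close>, and the nodes now carry coefficients that absorb the weight. The
integrability of \<open>ln \<mu> t / (1 + t\<^sup>2)\<close> is what makes such multipliers possible: it means, for a weight that is
monotone on the positive half-line, that the series of \<open>ln (\<mu> (2 ^ m)) / 2 ^ m\<close> converges, and a product of factors \<open>sin (r z) / (r z)\<close>, about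
\<open>ln (\<mu> (2 ^ Suc m))\<close> of them with \<open>r = exp 1 / 2 ^ m\<close>, has the required decay on each dyadic shell
and a type comparable to the sum of that series. Finite partial products suffice, because their types are
uniformly bounded and each finite stage of the interpolation formula sees only finitely many nodes.

Two points remain. The interpolation formula wants \<open>f\<close> bounded on the real line; this follows by
applying it to increments of a primitive of \<open>f\<close>, which grow at most linearly
(lemma \<open>bounded_on_real_line\<close>). And the pointwise bound (lemma \<open>pointwise_bernstein\<close>) is turned into a norm
bound by the power mean inequality for series and termwise integration. Since \<open>\<sigma> \<ge> 1\<close>, the
translations are by \<open>t / \<sigma>\<close> with \<open>\<mu> (t / \<sigma>) \<le> \<mu> t\<close> for \<open>t > 0\<close>, which is why the constant is
independent of \<open>\<sigma>\<close>.\<close>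

section \<open>A Phragmen-Lindelof principle\<close>

lemma entire_affine:
  fixes F :: "complex \<Rightarrow> complex"
  assumes "F holomorphic_on UNIV"
  shows "(\<lambda>z. F (a + b * z)) holomorphic_on UNIV"
  using holomorphic_on_compose_gen[OF _ assms, of "\<lambda>z. a + b * z" UNIV]
  by (simp add: o_def holomorphic_intros)

lemma deriv_entire_affine:
  assumes "F holomorphic_on UNIV"
  shows "deriv (\<lambda>z. F (a + b * z)) 0 = b * deriv F a"
proof -
  have "(F has_field_derivative deriv F a) (at a)"
    using assms by (auto intro!: holomorphic_derivI[where S=UNIV])
  moreover have "((\<lambda>z. a + b * z) has_field_derivative b) (at 0)"
    by (auto intro!: derivative_eq_intros)
  ultimately have "((\<lambda>z. F (a + b * z)) has_field_derivative deriv F a * b) (at 0)"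
    using DERIV_chain2[of F "deriv F a" "\<lambda>z. a + b * z" 0 b UNIV] by simp
  then show ?thesis by (simp add: DERIV_imp_deriv mult.commute)
qed

lemma deriv_even_entire:
  assumes "F holomorphic_on UNIV" "\<And>z. F (- z) = F z"
  shows "deriv F 0 = (0::complex)"
  using deriv_entire_affine[OF assms(1), of 0 "-1"] assms(2) by simp

text \<open>Multiplication by \<open>exp (\<i> * z)\<close> removes the factor \<open>exp (Im z)\<close>; the product is then bounded on both
rays that bound the octant. The further factor \<open>exp (- e * ((1 - \<i>) * z\<^sup>2))\<close> decays throughout the
octant, because the opening \<open>pi / 4\<close> is small enough for \<open>Re ((1 - \<i>) * z\<^sup>2) \<ge> (Re z)\<^sup>2\<close> to hold there.
So the maximum modulus principle applies on a large triangle, and \<open>e\<close> tends to \<open>0\<close>.\<close>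

lemma phragmen_lindelof_octant:
  assumes hol: "F holomorphic_on UNIV"
    and growth: "\<And>z. norm (F z) \<le> C * exp (norm z / 2)"
    and axis: "\<And>x. norm (F (complex_of_real x)) \<le> S"
    and z: "0 \<le> Im z" "Im z \<le> Re z"
  shows "norm (F z) \<le> max C S * exp (Im z)"
proof -
  have C0: "0 \<le> C"
    using growth[of 0] norm_ge_zero[of "F 0"] by (simp del: norm_ge_zero)
  have damped: "norm (F z) * exp (- Im z) * exp (- e * Re ((1 - \<i>) * z\<^sup>2)) \<le> max C S"
    if e: "e > 0" for e :: real
  proof -
    define H where "H w = F w * exp (\<i> * w) * exp (- complex_of_real e * ((1 - \<i>) * w\<^sup>2))" for w
    \<comment> \<open>On the side \<open>Re w = R\<close> of the triangle the damping \<open>exp (- e * R\<^sup>2)\<close> has to beat \<open>exp R\<close>,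
      hence \<open>R \<ge> 1 / e\<close>.\<close>
    define R where "R = max (1 / e) (Re z)"
    define T where "T = {w. 0 \<le> Im w \<and> Im w \<le> Re w \<and> Re w \<le> R}"
    have nH: "norm (H w) = norm (F w) * exp (- Im w) * exp (- e * Re ((1 - \<i>) * w\<^sup>2))" for w
      by (simp add: H_def norm_mult)
    have holH: "H holomorphic_on UNIV"
      unfolding H_def using hol by (intro holomorphic_intros) auto
    have sq: "Re ((1 - \<i>) * w\<^sup>2) = (Re w)\<^sup>2 - (Im w)\<^sup>2 + 2 * Re w * Im w" for w
      by (simp add: power2_eq_square algebra_simps)
    have T_eq: "T = {w. 0 \<le> Im w} \<inter> {w. Im w \<le> Re w} \<inter> {w. Re w \<le> R}"
      by (auto simp: T_def)
    have "closed T"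
      unfolding T_eq by (intro closed_Int closed_Collect_le continuous_intros)
    have "bounded T"
    proof (rule boundedI[where B="2 * R"])
      fix w assume "w \<in> T"
      then show "norm w \<le> 2 * R"
        using cmod_le[of w] by (auto simp: T_def)
    qed
    have open_sub: "{w. 0 < Im w} \<inter> {w. Im w < Re w} \<inter> {w. Re w < R} \<subseteq> interior T"
      by (rule interior_maximal)
        (auto simp: T_def intro!: open_Int open_Collect_less continuous_intros)
    have "norm (H z) \<le> max C S"
    proof (rule maximum_modulus_frontier[of H T])
      show "H holomorphic_on interior T" "continuous_on (closure T) H"
        using holH holomorphic_on_subset holomorphic_on_imp_continuous_on by blast+
      show "bounded T" by fact
      show "z \<in> T" using z by (auto simp: T_def R_def)
      fix w assume "w \<in> frontier T"
      then have wT: "w \<in> T" and nint: "w \<notin> interior T"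
        using \<open>closed T\<close> by (auto simp: frontier_def)
      then have w: "0 \<le> Im w" "Im w \<le> Re w" "Re w \<le> R"
        by (auto simp: T_def)
      have sqge: "(Re w)\<^sup>2 \<le> Re ((1 - \<i>) * w\<^sup>2)"
      proof -
        have "Im w * Im w \<le> Re w * Im w" "0 \<le> Re w * Im w"
          using w by (auto intro: mult_right_mono)
        then show ?thesis unfolding sq by (simp add: power2_eq_square)
      qed
      then have sq0: "0 \<le> Re ((1 - \<i>) * w\<^sup>2)"
        using zero_le_power2 order_trans by blast
      have damp1: "exp (- e * Re ((1 - \<i>) * w\<^sup>2)) \<le> 1"
        using e sq0 by simp
      have "\<not> (0 < Im w \<and> Im w < Re w \<and> Re w < R)"
        using nint open_sub by auto
      then consider "Im w = 0" | "Im w = Re w" | "Re w = R"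
        using w by linarith
      then show "norm (H w) \<le> max C S"
      proof cases
        case 1
        then have "w = complex_of_real (Re w)"
          by (simp add: complex_eq_iff)
        then have "norm (F w) \<le> S"
          using axis by metis
        then have "norm (F w) * exp (- e * Re ((1 - \<i>) * w\<^sup>2)) \<le> S * 1"
          using damp1 by (intro mult_mono) (auto intro: order_trans[OF norm_ge_zero])
        then show ?thesis unfolding nH using 1 by simp
      next
        case 2
        have "norm w \<le> 2 * Im w"
          using cmod_le[of w] 2 w by simp
        then have "norm (F w) * exp (- Im w) \<le> C * exp (Im w) * exp (- Im w)"
          using growth[of w] C0
          by (intro mult_right_mono) (auto elim!: order_trans intro!: mult_left_mono)
        then have "norm (F w) * exp (- Im w) \<le> C"
          by (simp only: mult.assoc flip: exp_add) simp
        then have "norm (H w) \<le> C * 1"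
          unfolding nH using damp1 C0 by (intro mult_mono) auto
        then show ?thesis by simp
      next
        case 3
        have "norm w / 2 - Im w \<le> R"
          using cmod_le[of w] 3 w by simp
        moreover have "R \<le> e * Re ((1 - \<i>) * w\<^sup>2)"
        proof -
          have "R * 1 \<le> R * (e * R)"
          proof (rule mult_left_mono)
            show "1 \<le> e * R"
              using e unfolding R_def by (simp add: max_def field_simps)
            show "0 \<le> R" using z unfolding R_def by simp
          qed
          also have "\<dots> = e * (Re w)\<^sup>2"
            using 3 by (simp add: power2_eq_square)
          also have "\<dots> \<le> e * Re ((1 - \<i>) * w\<^sup>2)"
            using sqge e by (intro mult_left_mono) auto
          finally show ?thesis by simp
        qed
        ultimately have le: "norm w / 2 + (- Im w) + (- e * Re ((1 - \<i>) * w\<^sup>2)) \<le> 0"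
          by linarith
        have "norm (H w) \<le> C * exp (norm w / 2) * exp (- Im w) * exp (- e * Re ((1 - \<i>) * w\<^sup>2))"
          unfolding nH using growth[of w] by (intro mult_right_mono) auto
        also have "\<dots> = C * exp (norm w / 2 + (- Im w) + (- e * Re ((1 - \<i>) * w\<^sup>2)))"
          by (simp only: exp_add mult.assoc)
        also have "\<dots> \<le> C * 1"
          using le C0 by (intro mult_left_mono) auto
        finally show ?thesis by simp
      qed
    qed
    then show ?thesis unfolding nH .
  qed
  have "((\<lambda>e. norm (F z) * exp (- Im z) * exp (- e * Re ((1 - \<i>) * z\<^sup>2)))
          \<longlongrightarrow> norm (F z) * exp (- Im z) * exp (- 0 * Re ((1 - \<i>) * z\<^sup>2))) (at_right 0)"
    by (intro tendsto_intros)
  then have "norm (F z) * exp (- Im z) * exp (- 0 * Re ((1 - \<i>) * z\<^sup>2)) \<le> max C S"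
    by (rule tendsto_upperbound)
      (use eventually_mono[OF eventually_at_right_less damped] in simp_all)
  then show ?thesis
    by (simp add: exp_minus field_simps)
qed

text \<open>Four of the eight octants touch the real axis and reduce to the previous lemma by the symmetries
\<open>z \<mapsto> - z\<close> and \<open>z \<mapsto> cnj z\<close>. In the other four \<open>norm z / 2 \<le> \<bar>Im z\<bar>\<close>, so the growth hypothesis is
already the claim.\<close>

lemma phragmen_lindelof_real_line:
  assumes hol: "F holomorphic_on UNIV"
    and growth: "\<And>z. norm (F z) \<le> C * exp (norm z / 2)"
    and axis: "\<And>x. norm (F (complex_of_real x)) \<le> S"
  shows "norm (F z) \<le> max C S * exp \<bar>Im z\<bar>"
proof -
  have C0: "0 \<le> C"
    using growth[of 0] norm_ge_zero[of "F 0"] by (simp del: norm_ge_zero)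
  have right: "norm (G w) \<le> max C S * exp \<bar>Im w\<bar>"
    if G: "G holomorphic_on UNIV" "\<And>z. norm (G z) \<le> C * exp (norm z / 2)"
        "\<And>x. norm (G (complex_of_real x)) \<le> S"
      and w: "\<bar>Im w\<bar> \<le> Re w" for G w
  proof (cases "0 \<le> Im w")
    case True
    then show ?thesis
      using phragmen_lindelof_octant[OF G, of w] w by simp
  next
    case False
    have "norm ((cnj \<circ> G \<circ> cnj) (cnj w)) \<le> max C S * exp (Im (cnj w))"
    proof (rule phragmen_lindelof_octant)
      show "(cnj \<circ> G \<circ> cnj) holomorphic_on UNIV"
        using G(1) by (intro holomorphic_on_compose_cnj_cnj) (auto simp: surj_def intro: exI[of _ "cnj _"])
      show "norm ((cnj \<circ> G \<circ> cnj) z) \<le> C * exp (norm z / 2)" for z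
        using G(2)[of "cnj z"] by simp
    qed (use G(3) False w in auto)
    then show ?thesis using False by simp
  qed
  consider "\<bar>Im z\<bar> \<le> Re z" | "\<bar>Im z\<bar> \<le> - Re z" | "\<bar>Re z\<bar> \<le> \<bar>Im z\<bar>"
    by linarith
  then show ?thesis
  proof cases
    case 1
    then show ?thesis using right[OF assms] by blast
  next
    case 2
    have "norm ((\<lambda>z. F (- z)) (- z)) \<le> max C S * exp \<bar>Im (- z)\<bar>"
    proof (rule right)
      show "(\<lambda>z. F (- z)) holomorphic_on UNIV"
        using entire_affine[OF hol, of 0 "-1"] by simp
      show "norm (F (- z)) \<le> C * exp (norm z / 2)" for z
        using growth[of "- z"] by simp
      show "norm (F (- complex_of_real x)) \<le> S" for x
        using axis[of "- x"] by simp
    qed (use 2 in auto)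
    then show ?thesis by simp
  next
    case 3
    have "norm (F z) \<le> C * exp (norm z / 2)"
      by (rule growth)
    also have "\<dots> \<le> max C S * exp \<bar>Im z\<bar>"
      using cmod_le[of z] 3 C0 by (intro mult_mono) auto
    finally show ?thesis .
  qed
qed

section \<open>Interpolation at the zeros of the cosine\<close>

definition node :: "nat \<Rightarrow> real" where
  "node j = (real j + 1 / 2) * pi"

lemma node_pos: "0 < node j"
  by (simp add: node_def)

lemma cos_node: "cos (node j) = 0"
  by (simp add: node_def distrib_right cos_add)

lemma abs_sin_node: "\<bar>sin (node j)\<bar> = 1"
  using cos_node sin_cos_squared_add[of "node j"] by (simp add: power2_eq_1_iff) auto

lemma cos_eq_0_imp_node:
  assumes "cos z = 0" "norm z < (real k + 1 / 2) * pi"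
  shows "\<exists>j<k. z = complex_of_real (node j) \<or> z = - complex_of_real (node j)"
proof -
  obtain n :: int where "z = complex_of_real (n * pi) + of_real pi / 2"
    using assms(1) by (auto simp: cos_eq_0)
  then have z: "z = complex_of_real ((of_int n + 1 / 2) * pi)"
    by (simp add: algebra_simps)
  have "norm z = \<bar>of_int n + 1 / 2\<bar> * pi"
    unfolding z by (simp only: norm_of_real abs_mult) simp
  then have n: "\<bar>of_int n + 1 / 2 :: real\<bar> < real k + 1 / 2"
    using assms(2) by simp
  show ?thesis
  proof (cases "0 \<le> n")
    case True
    then have "z = complex_of_real (node (nat n))" "nat n < k"
      using n by (auto simp: z node_def)
    then show ?thesis by blast
  next
    case False
    then have "nat (- n - 1) < k"
      using n by linarith
    moreover have "z = - complex_of_real (node (nat (- n - 1)))"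
      using False by (simp add: z node_def field_simps)
    ultimately show ?thesis by blast
  qed
qed

text \<open>On the circles of radius \<open>k * pi\<close> the cosine is as large as its growth allows: away from the
real axis by its exponential growth, and near the real axis because such a circle crosses the
axis at \<open>\<plusminus> k * pi\<close>, where the cosine has modulus \<open>1\<close>.\<close>

lemma exp_Im_le_norm_cos:
  assumes "norm z = real k * pi" "0 < k"
  shows "exp \<bar>Im z\<bar> \<le> 8 * norm (cos z)"
proof (cases "1 \<le> \<bar>Im z\<bar>")
  case True
  define E where "E = exp \<bar>Im z\<bar>"
  have "2 \<le> E"
    unfolding E_def using True exp_ge_add_one_self[of "\<bar>Im z\<bar>"] by linarith
  then have "inverse E \<le> E / 4"
    by (simp add: field_simps) (use mult_mono[of 2 E 2 E] in auto)
  then have "E / 2 \<le> E - inverse E" using \<open>2 \<le> E\<close> by linarith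
  then have "(E / 2)\<^sup>2 \<le> (E - inverse E)\<^sup>2"
    using \<open>2 \<le> E\<close> by (intro power_mono) auto
  also have "\<dots> = (exp (Im z) - inverse (exp (Im z)))\<^sup>2"
    by (cases "0 \<le> Im z") (auto simp: E_def exp_minus power2_commute)
  also have "\<dots> \<le> (2 * norm (cos z))\<^sup>2"
    by (simp add: power_mult_distrib norm_cos_squared)
  finally have "E / 2 \<le> 2 * norm (cos z)"
    by (rule power2_le_imp_le) simp
  then show ?thesis
    unfolding E_def using norm_ge_zero[of "cos z"] by linarith
next
  case False
  \<comment> \<open>the distance of \<open>\<bar>Re z\<bar>\<close> to the extremal point \<open>k * pi\<close>; it is about \<open>(Im z)\<^sup>2 / (2 * k * pi)\<close>\<close>
  define d where "d = real k * pi - \<bar>Re z\<bar>"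
  have d0: "0 \<le> d"
    using abs_Re_le_cmod[of z] assms by (simp add: d_def)
  have kpi: "3 \<le> real k * pi"
    using assms pi_gt3 mult_mono[of 1 "real k" 3 pi] by simp
  have "(real k * pi)\<^sup>2 = (Re z)\<^sup>2 + (Im z)\<^sup>2"
    using cmod_power2[of z] assms by simp
  then have "d * (real k * pi + \<bar>Re z\<bar>) = (Im z)\<^sup>2"
    by (simp add: d_def algebra_simps power2_eq_square)
  moreover have "d * 3 \<le> d * (real k * pi + \<bar>Re z\<bar>)"
    using kpi d0 by (intro mult_left_mono) auto
  moreover have "(Im z)\<^sup>2 \<le> 1"
    using False by (simp add: abs_square_le_1)
  ultimately have d1: "d \<le> pi / 3"
    using pi_gt3 by linarith
  have "1 / 2 \<le> cos d"
    using cos_monotone_0_pi_le[OF d0 d1] by (simp add: cos_60)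
  moreover have "\<bar>cos (Re z)\<bar> = \<bar>cos d\<bar>"
  proof -
    have "cos (Re z) = cos (real k * pi - d)"
      by (simp add: d_def)
    also have "\<dots> = (- 1) ^ k * cos d"
      by (simp add: cos_diff)
    finally show ?thesis
      by (simp add: abs_mult power_abs)
  qed
  moreover have "\<bar>cos (Re z)\<bar> \<le> norm (cos z)"
    by (rule power2_le_imp_le) (auto simp: norm_cos_squared)
  ultimately have "1 / 2 \<le> norm (cos z)"
    by linarith
  moreover have "exp \<bar>Im z\<bar> \<le> 4"
    using False exp_le exp_le_cancel_iff[of "\<bar>Im z\<bar>" 1] by linarith
  ultimately show ?thesis by linarith
qed

text \<open>The function \<open>G z / (z\<^sup>2 * cos z)\<close> has residue \<open>deriv G 0\<close> at \<open>0\<close> and residue of modulus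
\<open>norm (G q) / (norm q)\<^sup>2\<close> at a zero \<open>q\<close> of the cosine. On the circle of radius \<open>R = k * pi\<close> it is at
most \<open>8 * K / R\<^sup>2\<close>, which leaves the error term \<open>8 * K / R\<close>.\<close>

lemma norm_deriv_le_node_sum:
  assumes hol: "G holomorphic_on UNIV"
    and growth: "\<And>z. norm (G z) \<le> K * exp \<bar>Im z\<bar>"
    and k: "0 < k"
  shows "norm (deriv G 0)
    \<le> (\<Sum>j<k. (norm (G (of_real (node j))) + norm (G (- of_real (node j)))) / (node j)\<^sup>2)
        + 8 * K / (real k * pi)"
proof -
  define R where "R = real k * pi"
  have R: "0 < R" using k by (simp add: R_def)
  have R_lt: "R < (real k + 1 / 2) * pi"
    unfolding R_def by (intro mult_strict_right_mono) auto
  define g where "g z = G z / (z\<^sup>2 * cos z)" for z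
  define S where "S = ball (0::complex) ((real k + 1 / 2) * pi)"
  define Q where "Q = (\<lambda>j. complex_of_real (node j)) ` {..<k}"
  define Q' where "Q' = (\<lambda>j. - complex_of_real (node j)) ` {..<k}"
  define pts where "pts = insert 0 (Q \<union> Q')"
  have K0: "0 \<le> K"
    using growth[of 0] norm_ge_zero[of "G 0"] by (simp del: norm_ge_zero)
  have node_lt: "node j < R" if "j < k" for j
    using that unfolding node_def R_def by (intro mult_strict_right_mono) auto
  have inj: "inj_on (\<lambda>j. complex_of_real (node j)) {..<k}"
    "inj_on (\<lambda>j. - complex_of_real (node j)) {..<k}"
    by (auto simp: inj_on_def node_def)
  have zero_notin: "0 \<notin> Q \<union> Q'"
    using node_pos by (auto simp: Q_def Q'_def less_le)
  have disj: "Q \<inter> Q' = {}"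
  proof -
    have "complex_of_real (node i) \<noteq> - complex_of_real (node j)" for i j
      using node_pos[of i] node_pos[of j]
      by (simp only: of_real_minus[symmetric] of_real_eq_iff)
    then show ?thesis by (auto simp: Q_def Q'_def)
  qed
  have pts_norm: "norm q < R" if "q \<in> pts" for q
    using that R node_lt node_pos unfolding pts_def Q_def Q'_def
    by (auto simp: less_imp_le)
  have fin: "finite pts" by (simp add: pts_def Q_def Q'_def)
  have g_on: "g holomorphic_on S - pts"
    unfolding g_def
  proof (intro holomorphic_intros)
    show "G holomorphic_on S - pts" using hol holomorphic_on_subset by blast
    fix z assume z: "z \<in> S - pts"
    then have "z \<noteq> 0" by (auto simp: pts_def)
    moreover have "cos z \<noteq> 0"
      using cos_eq_0_imp_node[of z k] z by (auto simp: S_def pts_def Q_def Q'_def)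
    ultimately show "z\<^sup>2 * cos z \<noteq> 0" by simp
  qed
  have int: "contour_integral (circlepath 0 R) g
      = 2 * pi * \<i> * (\<Sum>q\<in>pts. winding_number (circlepath 0 R) q * residue g q)"
  proof (rule Residue_theorem)
    show "open S" "connected S" by (auto simp: S_def)
    show "finite pts" by (rule fin)
    show "g holomorphic_on S - pts" by (rule g_on)
    show "path_image (circlepath 0 R) \<subseteq> S - pts"
    proof
      fix z assume "z \<in> path_image (circlepath 0 R)"
      then have "norm z = R" using R by (simp add: path_image_circlepath)
      then show "z \<in> S - pts"
        using pts_norm[of z] R_lt by (auto simp: S_def)
    qed
    show "\<forall>z. z \<notin> S \<longrightarrow> winding_number (circlepath 0 R) z = 0"
    proof (intro allI impI)
      fix z assume "z \<notin> S"
      then show "winding_number (circlepath 0 R) z = 0"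
        using R R_lt by (intro winding_number_zero_outside[of _ "cball 0 R"])
          (auto simp: S_def path_image_circlepath)
    qed
  qed auto
  have "(\<Sum>q\<in>pts. winding_number (circlepath 0 R) q * residue g q) = (\<Sum>q\<in>pts. residue g q)"
    using pts_norm by (intro sum.cong) (auto simp: winding_number_circlepath)
  also have "\<dots> = residue g 0 + (\<Sum>q\<in>Q. residue g q) + (\<Sum>q\<in>Q'. residue g q)"
    using zero_notin disj unfolding pts_def
    by (subst sum.insert) (auto simp: Q_def Q'_def sum.union_disjoint)
  finally have sum_res: "(\<Sum>q\<in>pts. winding_number (circlepath 0 R) q * residue g q)
      = residue g 0 + (\<Sum>q\<in>Q. residue g q) + (\<Sum>q\<in>Q'. residue g q)" .
  have res0: "residue g 0 = deriv G 0"
  proof -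
    have cos0: "cos z \<noteq> 0" if "z \<in> ball 0 1" for z :: complex
      using cos_eq_0_imp_node[of z 0] that pi_gt3 by auto
    have "residue (\<lambda>z. (G z / cos z) / z ^ Suc 1) 0 = (deriv ^^ 1) (\<lambda>z. G z / cos z) 0 / fact 1"
      by (rule residue_holomorphic_over_power'[of "ball 0 1"])
        (use cos0 in \<open>auto intro!: holomorphic_intros holomorphic_on_subset[OF hol]\<close>)
    moreover have "((\<lambda>z. G z / cos z) has_field_derivative deriv G 0) (at 0)"
    proof -
      have "(G has_field_derivative deriv G 0) (at 0)"
        using hol by (auto intro!: holomorphic_derivI[where S=UNIV])
      then show ?thesis
        by (auto intro!: derivative_eq_intros)
    qed
    moreover have "(\<lambda>z. (G z / cos z) / z ^ Suc 1) = g"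
      by (auto simp: g_def fun_eq_iff power2_eq_square mult_ac)
    ultimately show ?thesis
      by (simp add: DERIV_imp_deriv)
  qed
  have res_pole: "norm (residue g q) = norm (G q) / (norm q)\<^sup>2"
    if "cos q = 0" "norm (sin q) = 1" "q \<in> Q \<union> Q'" for q
  proof -
    have "q \<noteq> 0"
      using that zero_notin by auto
    have "(cos has_field_derivative - sin q) (at q)"
      by (auto intro!: derivative_eq_intros)
    then have "((\<lambda>z. cos z / (z - q)) \<longlongrightarrow> - sin q) (at q)"
      using that by (simp add: has_field_derivative_iff)
    moreover have "(G \<longlongrightarrow> G q) (at q)"
      using holomorphic_on_imp_continuous_on[OF hol] by (simp add: continuous_on_def)
    ultimately have lim: "((\<lambda>z. (G z / z\<^sup>2) / (cos z / (z - q))) \<longlongrightarrow> (G q / q\<^sup>2) / (- sin q)) (at q)"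
      using that \<open>q \<noteq> 0\<close> by (intro tendsto_intros) auto
    have "q \<in> S"
      using pts_norm[of q] R_lt that by (auto simp: S_def pts_def)
    \<comment> \<open>Computing the residue as a limit includes the case \<open>G q = 0\<close>, in which \<open>q\<close> is not a pole.\<close>
    have "residue g q = (G q / q\<^sup>2) / (- sin q)"
    proof (rule residue_simple'[of "S - (pts - {q})"])
      show "((\<lambda>w. g w * (w - q)) \<longlongrightarrow> (G q / q\<^sup>2) / (- sin q)) (at q)"
        using lim by (simp add: g_def)
      show "g holomorphic_on S - (pts - {q}) - {q}"
        by (rule holomorphic_on_subset[OF g_on]) auto
    qed (use \<open>q \<in> S\<close> fin in \<open>auto simp: S_def intro!: open_Diff finite_imp_closed\<close>)
    then show ?thesis
      using that by (simp add: norm_divide norm_power norm_mult)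
  qed
  have rQ: "norm (residue g (of_real (node j))) = norm (G (of_real (node j))) / (node j)\<^sup>2"
    and rQ': "norm (residue g (- of_real (node j))) = norm (G (- of_real (node j))) / (node j)\<^sup>2"
    if "j < k" for j
    using res_pole[of "of_real (node j)"] res_pole[of "- of_real (node j)"]
      cos_node[of j] abs_sin_node[of j] that
    by (simp_all add: cos_of_real sin_of_real Q_def Q'_def)
  have "norm (contour_integral (circlepath 0 R) g) \<le> 8 * K / R\<^sup>2 * (2 * pi * R)"
  proof (rule has_contour_integral_bound_circlepath[of g _ 0 R])
    have "continuous_on (sphere 0 R) g"
      by (rule holomorphic_on_imp_continuous_on, rule holomorphic_on_subset[OF g_on])
        (use R_lt in \<open>auto simp: S_def dest: pts_norm\<close>)
    then show "(g has_contour_integral contour_integral (circlepath 0 R) g) (circlepath 0 R)"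
      using R by (intro has_contour_integral_integral contour_integrable_continuous_circlepath)
        (simp add: path_image_circlepath)
    fix z :: complex assume z: "norm (z - 0) = R"
    then have e: "exp \<bar>Im z\<bar> \<le> 8 * norm (cos z)"
      using exp_Im_le_norm_cos[of z k] k by (simp add: R_def)
    then have c: "0 < norm (cos z)"
      using exp_gt_zero[of "\<bar>Im z\<bar>"] by linarith
    have "norm (G z) \<le> K * (8 * norm (cos z))"
      using growth[of z] e K0 by (auto elim!: order_trans intro!: mult_left_mono)
    then show "norm (g z) \<le> 8 * K / R\<^sup>2"
      using z R c by (simp add: g_def norm_divide norm_mult norm_power field_simps)
  qed (use K0 R in auto)
  then have "2 * pi * norm (residue g 0 + (\<Sum>q\<in>Q. residue g q) + (\<Sum>q\<in>Q'. residue g q))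
      \<le> 2 * pi * (8 * K / R)"
    using R unfolding int sum_res norm_mult by (simp add: power2_eq_square mult_ac)
  then have "norm (residue g 0 + (\<Sum>q\<in>Q. residue g q) + (\<Sum>q\<in>Q'. residue g q)) \<le> 8 * K / R"
    by (rule mult_left_le_imp_le) simp
  moreover have "norm (residue g 0) \<le> norm (residue g 0 + (\<Sum>q\<in>Q. residue g q) + (\<Sum>q\<in>Q'. residue g q))
      + norm (\<Sum>q\<in>Q. residue g q) + norm (\<Sum>q\<in>Q'. residue g q)"
    by norm
  moreover have "norm (\<Sum>q\<in>Q. residue g q) \<le> (\<Sum>j<k. norm (G (of_real (node j))) / (node j)\<^sup>2)"
    unfolding Q_def by (subst sum.reindex[OF inj(1)]) (auto intro!: sum_norm_le simp: rQ)
  moreover have "norm (\<Sum>q\<in>Q'. residue g q) \<le> (\<Sum>j<k. norm (G (- of_real (node j))) / (node j)\<^sup>2)"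
    unfolding Q'_def by (subst sum.reindex[OF inj(2)]) (auto intro!: sum_norm_le simp: rQ')
  ultimately show ?thesis
    unfolding res0 by (simp add: add_divide_distrib sum.distrib R_def)
qed

text \<open>The preceding lemma after the change of variable \<open>z \<mapsto> z / T\<close>, which brings the type down to \<open>1 / 2\<close>.
The error term depends on \<open>G\<close> through \<open>C\<close> and \<open>S\<close> only; this uniformity allows \<open>G\<close> to vary with \<open>k\<close>.\<close>

lemma norm_deriv_le_scaled_node_sum:
  assumes hol: "G holomorphic_on UNIV"
    and growth: "\<And>z. norm (G z) \<le> C * exp (\<tau> * norm z)"
    and axis: "\<And>x. norm (G (complex_of_real x)) \<le> S"
    and T: "0 < T" "2 * \<tau> \<le> T" and k: "0 < k"
  shows "norm (deriv G 0)
    \<le> T * ((\<Sum>j<k. (norm (G (of_real (node j / T))) + norm (G (of_real (- (node j / T))))) / (node j)\<^sup>2)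
        + 8 * max C S / (real k * pi))"
proof -
  define H where "H z = G (0 + of_real (1 / T) * z)" for z
  have C0: "0 \<le> C"
    using growth[of 0] norm_ge_zero[of "G 0"] by (simp del: norm_ge_zero)
  have holH: "H holomorphic_on UNIV"
    unfolding H_def by (rule entire_affine[OF hol])
  have gH: "norm (H z) \<le> C * exp (norm z / 2)" for z
  proof -
    have "norm (H z) \<le> C * exp (\<tau> * (norm z / T))"
      using growth[of "of_real (1 / T) * z"] T by (simp add: H_def norm_mult norm_divide)
    also have "\<tau> * (norm z / T) \<le> norm z / 2"
      using mult_right_mono[OF T(2), of "norm z"] T(1) by (simp add: field_simps)
    finally show ?thesis using C0 by (auto intro: mult_left_mono)
  qed
  have aH: "norm (H (of_real x)) \<le> S" for x
    using axis[of "x / T"] by (simp add: H_def)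
  have "norm (deriv H 0)
    \<le> (\<Sum>j<k. (norm (H (of_real (node j))) + norm (H (- of_real (node j)))) / (node j)\<^sup>2)
        + 8 * max C S / (real k * pi)"
    by (intro norm_deriv_le_node_sum holH k phragmen_lindelof_real_line gH aH)
  moreover have "deriv H 0 = deriv G 0 / of_real T"
    unfolding H_def using deriv_entire_affine[OF hol, of 0 "of_real (1 / T)"] by simp
  ultimately have "norm (deriv G 0) / T
    \<le> (\<Sum>j<k. (norm (H (of_real (node j))) + norm (H (- of_real (node j)))) / (node j)\<^sup>2)
        + 8 * max C S / (real k * pi)"
    using T(1) by (simp add: norm_divide)
  then show ?thesis
    using T(1) by (simp add: H_def field_simps)
qed

section \<open>Multipliers of finite exponential type\<close>

definition csinc :: "complex \<Rightarrow> complex" where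
  "csinc z = (if z = 0 then 1 else sin z / z)"

lemma csinc_0 [simp]: "csinc 0 = 1"
  by (simp add: csinc_def)

lemma csinc_minus: "csinc (- z) = csinc z"
  by (simp add: csinc_def)

lemma holomorphic_csinc: "csinc holomorphic_on UNIV"
proof (rule no_isolated_singularity'[of "{0}"])
  fix z :: complex assume "z \<in> {0}"
  moreover have "((\<lambda>z. sin z / z) \<longlongrightarrow> 1) (at (0::complex))"
    using DERIV_sin[of "0::complex"] by (simp add: has_field_derivative_iff)
  then have "(csinc \<longlongrightarrow> 1) (at 0)"
    by (rule Lim_transform_eventually) (auto simp: csinc_def eventually_at_filter)
  ultimately show "(csinc \<longlongrightarrow> csinc z) (at z within UNIV)" by simp
next
  have "(\<lambda>z. sin z / z) holomorphic_on UNIV - {0}"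
    by (auto intro!: holomorphic_intros)
  then show "csinc holomorphic_on UNIV - {0}"
    by (rule holomorphic_transform) (auto simp: csinc_def)
qed auto

lemma norm_csinc_le: "norm (csinc z) \<le> exp (norm z)"
proof (cases "z = 0")
  case False
  have "norm (sin z - sin 0) \<le> exp (norm z) * norm (z - 0)"
  proof (rule field_differentiable_bound[of "cball 0 (norm z)" sin cos])
    show "norm (cos w) \<le> exp (norm z)" if "w \<in> cball 0 (norm z)" for w :: complex
      using norm_cos_le[of w] that by (auto elim!: order_trans)
  qed (auto intro!: derivative_eq_intros)
  then show ?thesis
    using False by (simp add: csinc_def norm_divide divide_le_eq)
qed auto

lemma norm_csinc_real:
  "norm (csinc (of_real x)) \<le> 1"
  "norm (csinc (of_real x)) * \<bar>x\<bar> \<le> 1"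
  using abs_sin_x_le_abs_x[of x] abs_sin_le_one[of x]
  by (auto simp: csinc_def norm_divide sin_of_real divide_le_eq simp del: abs_sin_le_one)

text \<open>A factor \<open>csinc (r * z)\<close> costs the type \<open>r\<close>, and on the real line it is at most \<open>exp (- 1)\<close> from
\<open>\<bar>x\<bar> = exp 1 / r\<close> on. With \<open>r = exp 1 / 2 ^ m\<close> the \<open>N m\<close> factors of index \<open>m\<close> therefore produce the decay
\<open>exp (- N m)\<close> for \<open>\<bar>x\<bar> \<ge> 2 ^ m\<close>.\<close>

definition multiplier :: "(nat \<Rightarrow> nat) \<Rightarrow> nat \<Rightarrow> complex \<Rightarrow> complex" where
  "multiplier N M z = (\<Prod>m<M. csinc (of_real (exp 1 / 2 ^ m) * z) ^ N m)"

lemma multiplier_0 [simp]: "multiplier N M 0 = 1"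
  by (simp add: multiplier_def)

lemma holomorphic_multiplier: "multiplier N M holomorphic_on UNIV"
proof -
  have "(\<lambda>z. csinc (of_real c * z)) holomorphic_on UNIV" for c
    using entire_affine[OF holomorphic_csinc, of 0] by simp
  then show ?thesis
    unfolding multiplier_def by (intro holomorphic_intros)
qed

lemma deriv_multiplier_0: "deriv (multiplier N M) 0 = 0"
  by (rule deriv_even_entire[OF holomorphic_multiplier]) (simp add: multiplier_def csinc_minus)

lemma norm_multiplier_le:
  "norm (multiplier N M z) \<le> exp ((\<Sum>m<M. real (N m) * (exp 1 / 2 ^ m)) * norm z)"
proof -
  have "norm (multiplier N M z) \<le> (\<Prod>m<M. exp (real (N m) * (exp 1 / 2 ^ m) * norm z))"
    unfolding multiplier_def prod_norm[symmetric]
  proof (intro prod_mono conjI norm_ge_zero)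
    fix m
    have "norm (csinc (of_real (exp 1 / 2 ^ m) * z)) \<le> exp (exp 1 / 2 ^ m * norm z)"
      using norm_csinc_le[of "of_real (exp 1 / 2 ^ m) * z"] by (simp add: norm_mult norm_divide norm_power)
    then have "norm (csinc (of_real (exp 1 / 2 ^ m) * z)) ^ N m \<le> exp (exp 1 / 2 ^ m * norm z) ^ N m"
      by (rule power_mono) simp
    then show "norm (csinc (of_real (exp 1 / 2 ^ m) * z) ^ N m) \<le> exp (real (N m) * (exp 1 / 2 ^ m) * norm z)"
      by (simp add: norm_power exp_of_nat_mult[symmetric] mult.assoc)
  qed
  then show ?thesis
    by (simp add: exp_sum sum_distrib_right)
qed

lemma norm_multiplier_real_le_factor:
  assumes "m < M"
  shows "norm (multiplier N M (of_real x)) \<le> norm (csinc (of_real (exp 1 / 2 ^ m * x))) ^ N m"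
proof -
  have "norm (multiplier N M (of_real x))
      = norm (csinc (of_real (exp 1 / 2 ^ m * x))) ^ N m
        * (\<Prod>i\<in>{..<M} - {m}. norm (csinc (of_real (exp 1 / 2 ^ i * x))) ^ N i)"
    unfolding multiplier_def prod_norm[symmetric] norm_power using assms
    by (subst prod.remove[of _ m]) auto
  also have "\<dots> \<le> norm (csinc (of_real (exp 1 / 2 ^ m * x))) ^ N m * 1"
    by (intro mult_left_mono prod_le_1 conjI power_le_one norm_csinc_real) auto
  finally show ?thesis by simp
qed

lemma norm_multiplier_real_le_1: "norm (multiplier N M (of_real x)) \<le> 1"
proof -
  have "norm (csinc (of_real (exp 1 / 2 ^ i) * of_real x)) \<le> 1" for i
    using norm_csinc_real(1)[of "exp 1 / 2 ^ i * x"] by simp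
  then show ?thesis
    unfolding multiplier_def prod_norm[symmetric] norm_power
    by (intro prod_le_1 conjI power_le_one) auto
qed

lemma norm_multiplier_dyadic:
  assumes "m < M" "2 ^ m \<le> \<bar>x\<bar>"
  shows "norm (multiplier N M (of_real x)) \<le> exp (- real (N m))"
proof -
  have "exp 1 \<le> \<bar>exp 1 / 2 ^ m * x\<bar>"
    using assms(2) by (simp add: abs_mult field_simps)
  then have "norm (csinc (of_real (exp 1 / 2 ^ m * x))) * exp 1
      \<le> norm (csinc (of_real (exp 1 / 2 ^ m * x))) * \<bar>exp 1 / 2 ^ m * x\<bar>"
    by (intro mult_left_mono) auto
  also have "\<dots> \<le> 1" by (rule norm_csinc_real)
  finally have "norm (csinc (of_real (exp 1 / 2 ^ m * x))) \<le> exp (- 1)"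
    by (simp add: exp_minus field_simps)
  then have "norm (csinc (of_real (exp 1 / 2 ^ m * x))) ^ N m \<le> exp (- 1) ^ N m"
    by (rule power_mono) simp
  also have "\<dots> = exp (- real (N m))"
    by (simp add: exp_of_nat_mult[symmetric])
  finally show ?thesis
    using norm_multiplier_real_le_factor[OF assms(1)] order_trans by blast
qed

section \<open>Weights with integrable logarithm\<close>

text \<open>On the shell \<open>2 ^ m \<le> t < 2 ^ Suc m\<close>, of length \<open>2 ^ m\<close>, monotonicity bounds the integrand below by
\<open>\<omega> (2 ^ m) / (5 * 4 ^ m)\<close>, so each term of the series is at most five times the integral over its shell.\<close>

lemma summable_dyadic:
  fixes \<omega> :: "real \<Rightarrow> real"
  assumes mono: "mono_on {0<..} \<omega>" and nonneg: "\<And>t. 0 \<le> \<omega> t"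
    and int: "integrable lebesgue (\<lambda>t. \<omega> t / (1 + t\<^sup>2))"
  shows "summable (\<lambda>m. \<omega> (2 ^ m) / 2 ^ m)"
proof (rule summableI_nonneg_bounded)
  show "0 \<le> \<omega> (2 ^ m) / 2 ^ m" for m using nonneg by simp
  fix n
  \<comment> \<open>\<open>1 + t\<^sup>2 \<le> 1 + 4 * 4 ^ m \<le> 5 * 4 ^ m\<close> on the \<open>m\<close>-th shell\<close>
  define c where "c m = \<omega> (2 ^ m) / (5 * 4 ^ m)" for m :: nat
  define A where "A m = {2 ^ m ..< 2 ^ Suc m :: real}" for m :: nat
  have A_fin: "emeasure lebesgue (A m) < \<infinity>" "A m \<in> sets lebesgue" "measure lebesgue (A m) = 2 ^ m" for m
    by (auto simp: A_def)
  have intA: "integrable lebesgue (\<lambda>t. c m * indicator (A m) t)" for m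
    using A_fin by (intro integrable_mult_right integrable_real_indicator) auto
  have le: "(\<Sum>m<n. c m * indicator (A m) t) \<le> \<omega> t / (1 + t\<^sup>2)" for t
  proof (cases "\<exists>m. t \<in> A m")
    case True
    then obtain m where m: "2 ^ m \<le> t" "t < 2 ^ Suc m" by (auto simp: A_def)
    have uniq: "i = m" if "t \<in> A i" for i
    proof -
      have "(2::real) ^ i < 2 ^ Suc m" "(2::real) ^ m < 2 ^ Suc i"
        using that m unfolding A_def by auto
      then show ?thesis by (simp only: power_strict_increasing_iff)
    qed
    have t0: "0 < t" using m(1) zero_less_power[of "2::real" m] by linarith
    have "t\<^sup>2 \<le> (2 ^ Suc m)\<^sup>2"
      using m t0 by (intro power_mono) auto
    also have "\<dots> = 4 * 4 ^ m"
    proof -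
      have "(2::real) ^ m * 2 ^ m = 4 ^ m" by (simp flip: power_mult_distrib)
      then show ?thesis by (simp add: power2_eq_square)
    qed
    finally have "1 + t\<^sup>2 \<le> 5 * 4 ^ m"
      using one_le_power[of "4::real" m] by linarith
    moreover have "\<omega> (2 ^ m) \<le> \<omega> t"
      using mono m t0 by (auto simp: mono_on_def)
    ultimately have "c m \<le> \<omega> t / (1 + t\<^sup>2)"
      unfolding c_def using nonneg by (intro frac_le) (auto intro: add_pos_nonneg)
    moreover have "(\<Sum>i<n. c i * indicator (A i) t) \<le> (\<Sum>i<n. if i = m then c m else 0)"
    proof (rule sum_mono)
      fix i
      have "0 \<le> c m" using nonneg by (simp add: c_def)
      then show "c i * indicator (A i) t \<le> (if i = m then c m else 0)"
        using uniq[of i] by (cases "t \<in> A i") auto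
    qed
    moreover have "(\<Sum>i<n. if i = m then c m else 0) \<le> c m"
      using nonneg by (simp add: c_def)
    ultimately show ?thesis by linarith
  next
    case False
    then have "(\<Sum>m<n. c m * indicator (A m) t) = 0" by simp
    then show ?thesis using nonneg by (simp add: add_nonneg_nonneg)
  qed
  have "(\<Sum>m<n. \<omega> (2 ^ m) / 2 ^ m) / 5 = (\<Sum>m<n. c m * measure lebesgue (A m))"
    unfolding sum_divide_distrib
  proof (rule sum.cong)
    fix m
    have "(4::real) ^ m = 2 ^ m * 2 ^ m" by (simp flip: power_mult_distrib)
    then show "\<omega> (2 ^ m) / 2 ^ m / 5 = c m * measure lebesgue (A m)"
      by (simp add: A_fin c_def)
  qed simp
  also have "\<dots> = (LINT t|lebesgue. (\<Sum>m<n. c m * indicator (A m) t))"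
    using intA A_fin by (subst Bochner_Integration.integral_sum) auto
  also have "\<dots> \<le> (LINT t|lebesgue. \<omega> t / (1 + t\<^sup>2))"
    using le intA int by (intro integral_mono Bochner_Integration.integrable_sum) auto
  finally show "(\<Sum>m<n. \<omega> (2 ^ m) / 2 ^ m) \<le> 5 * (LINT t|lebesgue. \<omega> t / (1 + t\<^sup>2))"
    by simp
qed

lemma dyadic_interval:
  fixes x :: real
  assumes "1 \<le> x"
  obtains m where "2 ^ m \<le> x" "x < 2 ^ Suc m"
proof -
  have "2 powr of_int \<lfloor>log 2 x\<rfloor> \<le> x \<and> x < 2 powr (of_int \<lfloor>log 2 x\<rfloor> + 1)"
    using assms floor_log_eq_powr_iff[of x 2 "\<lfloor>log 2 x\<rfloor>"] by simp
  moreover have "0 \<le> \<lfloor>log 2 x\<rfloor>"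
    using assms by simp
  ultimately have "2 ^ nat \<lfloor>log 2 x\<rfloor> \<le> x" "x < 2 ^ Suc (nat \<lfloor>log 2 x\<rfloor>)"
    by (simp_all add: powr_add powr_realpow[symmetric])
  then show ?thesis by (rule that)
qed

text \<open>The integral condition is Beurling's condition of non-quasi-analyticity.\<close>

locale beurling_weight =
  fixes \<mu> :: "real \<Rightarrow> real"
  assumes ge_1: "1 \<le> \<mu> t"
    and even: "\<mu> (- t) = \<mu> t"
    and mono: "mono_on {0<..} \<mu>"
    and log_integrable: "integrable lebesgue (\<lambda>t. ln (\<mu> t) / (1 + t\<^sup>2))"
begin

lemma pos: "0 < \<mu> t"
  using ge_1[of t] by linarith

text \<open>The case \<open>s = 0\<close> is a genuine exception: the weight is monotone on the open half-line, and its value at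
\<open>0\<close> may exceed all the others.\<close>

lemma mono_abs:
  assumes "s \<noteq> 0" "\<bar>s\<bar> \<le> \<bar>t\<bar>"
  shows "\<mu> s \<le> \<mu> t"
proof -
  have "\<mu> \<bar>s\<bar> \<le> \<mu> \<bar>t\<bar>"
    using assms mono by (auto simp: mono_on_def)
  then show ?thesis
    by (simp add: abs_if even split: if_splits)
qed

text \<open>The argument \<open>2 ^ Suc m\<close> is the right end of the shell on which the factors of index \<open>m\<close> have to
dominate the weight.\<close>

definition mult_exponent :: "nat \<Rightarrow> nat" where
  "mult_exponent m = nat \<lceil>ln (\<mu> (2 ^ Suc m))\<rceil>"

definition mult_type :: real where
  "mult_type = (\<Sum>m. real (mult_exponent m) * (exp 1 / 2 ^ m))"

lemma summable_mult_type: "summable (\<lambda>m. real (mult_exponent m) * (exp 1 / 2 ^ m))"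
proof (rule summable_comparison_test)
  have "summable (\<lambda>m. ln (\<mu> (2 ^ m)) / 2 ^ m)"
  proof (rule summable_dyadic)
    show "mono_on {0<..} (\<lambda>t. ln (\<mu> t))"
      using mono pos by (auto simp: mono_on_def)
  qed (use ge_1 log_integrable in auto)
  then have "summable (\<lambda>m. ln (\<mu> (2 ^ Suc m)) / 2 ^ Suc m)"
    by (simp only: summable_Suc_iff[where f="\<lambda>m. ln (\<mu> (2 ^ m)) / 2 ^ m"])
  moreover have "summable (\<lambda>m. (1 / 2 :: real) ^ m)"
    by (simp add: summable_geometric_iff)
  ultimately show "summable (\<lambda>m. exp 1 * (2 * (ln (\<mu> (2 ^ Suc m)) / 2 ^ Suc m) + (1 / 2) ^ m))"
    by (intro summable_mult summable_add)
  have "real (mult_exponent m) * (exp 1 / 2 ^ m) \<le> exp 1 * (2 * (ln (\<mu> (2 ^ Suc m)) / 2 ^ Suc m) + (1 / 2) ^ m)" for m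
  proof -
    have "0 \<le> ln (\<mu> (2 ^ Suc m))" using ge_1 by simp
    then have "real (mult_exponent m) \<le> ln (\<mu> (2 ^ Suc m)) + 1"
      unfolding mult_exponent_def by linarith
    then have "real (mult_exponent m) * (exp 1 / 2 ^ m) \<le> (ln (\<mu> (2 ^ Suc m)) + 1) * (exp 1 / 2 ^ m)"
      by (intro mult_right_mono) auto
    then show ?thesis by (simp add: field_simps)
  qed
  then show "\<exists>n0. \<forall>m\<ge>n0. norm (real (mult_exponent m) * (exp 1 / 2 ^ m))
      \<le> exp 1 * (2 * (ln (\<mu> (2 ^ Suc m)) / 2 ^ Suc m) + (1 / 2) ^ m)"
    by (simp del: power_Suc)
qed

lemma mult_type_nonneg: "0 \<le> mult_type"
  unfolding mult_type_def by (intro suminf_nonneg summable_mult_type) auto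

text \<open>The type does not depend on the number \<open>M\<close> of blocks, so truncating the product loses nothing in
the estimates that involve the type.\<close>

lemma multiplier_growth:
  "norm (multiplier mult_exponent M z) \<le> exp (mult_type * norm z)"
proof -
  have "(\<Sum>m<M. real (mult_exponent m) * (exp 1 / 2 ^ m)) \<le> mult_type"
    unfolding mult_type_def by (intro sum_le_suminf summable_mult_type) auto
  then show ?thesis
    by (intro order_trans[OF norm_multiplier_le]) (auto intro: mult_right_mono)
qed

text \<open>If \<open>2 ^ m \<le> \<bar>x\<bar> < 2 ^ Suc m\<close>, the block of index \<open>m\<close> alone gives \<open>exp (- ln (\<mu> (2 ^ Suc m)))\<close>. The
constant \<open>\<mu> 1\<close> takes care of \<open>\<bar>x\<bar> < 1\<close>, where the multiplier is only known to be at most \<open>1\<close>.\<close>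

lemma multiplier_decay:
  assumes "x \<noteq> 0" "\<bar>x\<bar> < 2 ^ M"
  shows "norm (multiplier mult_exponent M (of_real x)) \<le> \<mu> 1 / \<mu> x"
proof (cases "1 \<le> \<bar>x\<bar>")
  case True
  then obtain m where m: "2 ^ m \<le> \<bar>x\<bar>" "\<bar>x\<bar> < 2 ^ Suc m"
    by (rule dyadic_interval)
  have "(2::real) ^ m < 2 ^ M" using m assms by linarith
  then have "m < M" by simp
  then have "norm (multiplier mult_exponent M (of_real x)) \<le> exp (- real (mult_exponent m))"
    using m by (intro norm_multiplier_dyadic)
  also have "\<dots> \<le> exp (- ln (\<mu> (2 ^ Suc m)))"
    unfolding mult_exponent_def using real_nat_ceiling_ge by simp
  also have "\<dots> = 1 / \<mu> (2 ^ Suc m)"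
    using pos by (simp add: exp_minus inverse_eq_divide)
  also have "\<dots> \<le> 1 / \<mu> x"
    using m assms pos by (intro divide_left_mono mono_abs) auto
  also have "\<dots> \<le> \<mu> 1 / \<mu> x"
    using pos ge_1 by (intro divide_right_mono) (auto simp: less_imp_le)
  finally show ?thesis .
next
  case False
  then have "\<mu> x \<le> \<mu> 1"
    using assms by (intro mono_abs) auto
  then have "1 \<le> \<mu> 1 / \<mu> x"
    using pos by simp
  then show ?thesis
    using norm_multiplier_real_le_1 order_trans by blast
qed

end

section \<open>Boundedness on the real line\<close>

lemma summable_node: "summable (\<lambda>j. 1 / (node j)\<^sup>2)"
proof (rule summable_comparison_test)
  have "summable (\<lambda>j. inverse (real (Suc j)) ^ 2)"
    using summable_Suc_iff[where f="\<lambda>j. inverse (real j) ^ 2"] inverse_power_summable[of 2, where 'a=real]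
    by (simp add: power_inverse)
  then show "summable (\<lambda>j. inverse (real (Suc j)) ^ 2)" .
  have "1 / (node j)\<^sup>2 \<le> inverse (real (Suc j)) ^ 2" for j
  proof -
    have "real (Suc j) \<le> (real j + 1 / 2) * 2" by simp
    also have "\<dots> \<le> node j"
      unfolding node_def using pi_ge_two by (intro mult_left_mono) auto
    finally have "(real (Suc j))\<^sup>2 \<le> (node j)\<^sup>2" by (intro power_mono) auto
    then have "1 / (node j)\<^sup>2 \<le> 1 / (real (Suc j))\<^sup>2" by (intro frac_le) auto
    then show ?thesis
      by (simp add: power_divide inverse_eq_divide del: of_nat_Suc)
  qed
  then show "\<exists>n0. \<forall>j\<ge>n0. norm (1 / (node j)\<^sup>2) \<le> inverse (real (Suc j)) ^ 2"
    by simp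
qed

lemma le_of_le_add_inverse_nat:
  fixes a b c :: real
  assumes "\<And>k. 0 < k \<Longrightarrow> a \<le> b + c / real k"
  shows "a \<le> b"
proof (rule LIMSEQ_le_const)
  have "(\<lambda>k. b + c * (1 / real k)) \<longlonglongrightarrow> b + c * 0"
    by (intro tendsto_intros lim_1_over_n)
  then show "(\<lambda>k. b + c / real k) \<longlonglongrightarrow> b" by simp
  show "\<exists>N. \<forall>k\<ge>N. a \<le> b + c / real k"
    using assms by (intro exI[of _ 1]) auto
qed

text \<open>The choice \<open>\<epsilon> = \<sigma>\<close> in the definition of exponential type trades the sharp type for a single constant; it
costs a factor \<open>2\<close> in the type, which only enters the final constant.\<close>

lemma exponential_type_translate:
  assumes "exponential_type \<sigma> F" "0 < \<sigma>"
  obtains C where "0 < C" "\<And>z. norm (F (x + z)) \<le> C * exp (2 * \<sigma> * norm z)"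
proof -
  obtain C where C: "0 < C" "\<And>z. norm (F z) \<le> C * exp (2 * \<sigma> * norm z)"
    using assms unfolding exponential_type_def mult_2 by blast
  have "norm (F (x + z)) \<le> C * exp (2 * \<sigma> * norm x) * exp (2 * \<sigma> * norm z)" for z
  proof -
    have "norm (F (x + z)) \<le> C * exp (2 * \<sigma> * norm (x + z))"
      by (rule C)
    also have "\<dots> \<le> C * exp (2 * \<sigma> * (norm x + norm z))"
      using C(1) assms(2) by (intro mult_left_mono) (auto intro!: mult_left_mono norm_triangle_ineq)
    finally show ?thesis
      by (simp add: distrib_left exp_add mult.assoc)
  qed
  then show ?thesis
    using C(1) by (intro that[of "C * exp (2 * \<sigma> * norm x)"]) auto
qed

text \<open>From \<open>u \<le> 1 + u powr p\<close> for \<open>u \<ge> 0\<close>, integrated along the segment. Unlike Hoelder's inequality this gives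
linear growth only, but linear growth is what one factor \<open>csinc\<close> can absorb.\<close>

lemma primitive_increment_le:
  fixes F P :: "complex \<Rightarrow> complex"
  assumes hol: "F holomorphic_on UNIV"
    and P: "\<And>z. (P has_field_derivative F z) (at z)"
    and p: "1 \<le> p"
    and int: "integrable lebesgue (\<lambda>s. norm (F (of_real s)) powr p)"
  shows "norm (P (of_real (x + t)) - P (of_real x))
    \<le> \<bar>t\<bar> + (LINT s|lebesgue. norm (F (of_real s)) powr p)"
proof -
  define I where "I = (LINT s|lebesgue. norm (F (of_real s)) powr p)"
  have cont: "continuous_on A (\<lambda>s. F (of_real s))" for A
    using holomorphic_on_imp_continuous_on[OF hol]
    by (intro continuous_on_compose2[OF _ continuous_on_of_real]) (auto intro: continuous_on_id)
  have UN: "(\<lambda>s. norm (F (of_real s)) powr p) integrable_on UNIV"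
    "integral UNIV (\<lambda>s. norm (F (of_real s)) powr p) = I"
    using int by (auto simp: I_def integrable_on_lebesgue integral_lebesgue)
  have incr: "norm (P (of_real b) - P (of_real a)) \<le> (b - a) + I" if "a \<le> b" for a b :: real
  proof -
    have FT: "((\<lambda>s. F (of_real s)) has_integral (P (of_real b) - P (of_real a))) {a..b}"
      using that P by (intro fundamental_theorem_of_calculus has_vector_derivative_real_field)
    have ints: "(\<lambda>s. norm (F (of_real s)) powr p) integrable_on {a..b}"
      using p cont by (intro integrable_continuous_interval continuous_on_powr' continuous_intros) auto
    have "norm (integral {a..b} (\<lambda>s. F (of_real s)))
        \<le> integral {a..b} (\<lambda>s. 1 + norm (F (of_real s)) powr p)"
    proof (rule integral_norm_bound_integral)
      show "(\<lambda>s. 1 + norm (F (of_real s)) powr p) integrable_on {a..b}"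
        using ints by (intro integrable_add) auto
      fix s
      show "norm (F (of_real s)) \<le> 1 + norm (F (of_real s)) powr p"
      proof (cases "1 \<le> norm (F (of_real s))")
        case True
        then have "norm (F (of_real s)) powr 1 \<le> norm (F (of_real s)) powr p"
          using p by (intro powr_mono)
        moreover have "norm (F (of_real s)) powr 1 = norm (F (of_real s))"
          using True by simp
        ultimately show ?thesis by linarith
      next
        case False
        then show ?thesis using powr_ge_zero[of "norm (F (of_real s))" p] by linarith
      qed
    qed (use FT in auto)
    also have "\<dots> = (b - a) + integral {a..b} (\<lambda>s. norm (F (of_real s)) powr p)"
      using ints that by (subst integral_add) auto
    also have "integral {a..b} (\<lambda>s. norm (F (of_real s)) powr p)
        \<le> integral UNIV (\<lambda>s. norm (F (of_real s)) powr p)"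
      using ints UN by (intro integral_subset_le) auto
    finally show ?thesis
      using FT UN by (simp add: integral_unique)
  qed
  show ?thesis
    using incr[of x "x + t"] incr[of "x + t" x] unfolding I_def[symmetric]
    by (cases "0 \<le> t") (auto simp: norm_minus_commute)
qed

text \<open>Let \<open>P\<close> be a primitive of \<open>F\<close>. The function \<open>G z = (P (x + z) - P x) * csinc z\<close> has
\<open>deriv G 0 = F x\<close>, and on the real line it is bounded independently of \<open>x\<close>. So the interpolation bound
for \<open>G\<close> bounds \<open>F x\<close>; the constant \<open>C\<close> in the growth of \<open>G\<close> does depend on \<open>x\<close>, but it enters only
through the error term, which tends to \<open>0\<close>.\<close>

lemma bounded_on_real_line:
  assumes F: "exponential_type \<sigma> F" and \<sigma>: "0 < \<sigma>" and p: "1 \<le> p"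
    and int: "integrable lebesgue (\<lambda>s. norm (F (of_real s)) powr p)"
  obtains S where "\<And>x. norm (F (of_real x)) \<le> S"
proof -
  have hol: "F holomorphic_on UNIV" using F by (simp add: exponential_type_def)
  obtain P where P: "\<And>z. (P has_field_derivative F z) (at z)"
    using holomorphic_convex_primitive'[OF convex_UNIV open_UNIV hol] by auto
  define I where "I = (LINT s|lebesgue. norm (F (of_real s)) powr p)"
  define W where "W = (\<Sum>j. 1 / (node j)\<^sup>2)"
  define T where "T = 2 * (2 * \<sigma> + 2)"
  have I0: "0 \<le> I" unfolding I_def by (intro integral_nonneg_AE) auto
  have holP: "P holomorphic_on UNIV"
    using P by (auto simp: holomorphic_on_def field_differentiable_def)
  have "norm (F (of_real x)) \<le> T * (2 * (1 + I) * W)" for x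
  proof -
    obtain C where C: "0 < C" "\<And>z. norm (F (of_real x + z)) \<le> C * exp (2 * \<sigma> * norm z)"
      using exponential_type_translate[OF F \<sigma>] by metis
    define G where "G z = (P (of_real x + z) - P (of_real x)) * csinc z" for z
    have holPx: "(\<lambda>z. P (of_real x + z)) holomorphic_on UNIV"
      using entire_affine[OF holP, of "of_real x" 1] by simp
    have holG: "G holomorphic_on UNIV"
      unfolding G_def using holPx holomorphic_csinc by (intro holomorphic_intros)
    have growth: "norm (G z) \<le> C * exp ((2 * \<sigma> + 2) * norm z)" for z
    proof -
      have "norm (P (of_real x + z) - P (of_real x + 0)) \<le> C * exp (2 * \<sigma> * norm z) * norm (z - 0)"
      proof (rule field_differentiable_bound[of "cball 0 (norm z)" "\<lambda>z. P (of_real x + z)" "\<lambda>z. F (of_real x + z)"])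
        fix w :: complex assume w: "w \<in> cball 0 (norm z)"
        show "((\<lambda>z. P (of_real x + z)) has_field_derivative F (of_real x + w)) (at w within cball 0 (norm z))"
          using P[of "of_real x + w"] by (simp add: DERIV_at_within_shift_lemma has_field_derivative_at_within DERIV_shift add.commute)
        have "norm (F (of_real x + w)) \<le> C * exp (2 * \<sigma> * norm w)" by (rule C)
        also have "\<dots> \<le> C * exp (2 * \<sigma> * norm z)"
          using w C(1) \<sigma> by (intro mult_left_mono) auto
        finally show "norm (F (of_real x + w)) \<le> C * exp (2 * \<sigma> * norm z)" .
      qed auto
      also have "\<dots> \<le> C * exp (2 * \<sigma> * norm z) * exp (norm z)"
      proof -
        have "norm z \<le> exp (norm z)" using exp_ge_add_one_self[of "norm z"] by linarith
        then show ?thesis using C(1) by (intro mult_left_mono) auto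
      qed
      finally have "norm (G z) \<le> C * exp (2 * \<sigma> * norm z) * exp (norm z) * exp (norm z)"
        unfolding G_def norm_mult using C(1) norm_csinc_le by (intro mult_mono) auto
      moreover have "exp ((2 * \<sigma> + 2) * norm z) = exp (2 * \<sigma> * norm z) * exp (norm z) * exp (norm z)"
        by (simp add: algebra_simps flip: exp_add)
      ultimately show ?thesis
        by (simp only: mult.assoc)
    qed
    have axis: "norm (G (of_real t)) \<le> 1 + I" for t
    proof -
      have "norm (G (of_real t)) \<le> (\<bar>t\<bar> + I) * norm (csinc (of_real t))"
        unfolding G_def norm_mult I_def
        using primitive_increment_le[OF hol P p int, of x t] by (intro mult_right_mono) auto
      also have "\<dots> \<le> 1 + I"
        using norm_csinc_real[of t] I0 mult_left_le[of "norm (csinc (of_real t))" I]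
        by (simp add: distrib_right mult.commute)
      finally show ?thesis .
    qed
    have dG: "deriv G 0 = F (of_real x)"
    proof -
      have dP: "((\<lambda>z. P (of_real x + z)) has_field_derivative F (of_real x)) (at 0)"
        using P[of "of_real x"] DERIV_shift[of P "F (of_real x)" 0 "of_real x"] by (simp add: add.commute)
      have "(csinc has_field_derivative deriv csinc 0) (at 0)"
        using holomorphic_csinc by (auto intro!: holomorphic_derivI[where S=UNIV])
      then have "(G has_field_derivative F (of_real x)) (at 0)"
        unfolding G_def using dP by (auto intro!: derivative_eq_intros)
      then show ?thesis by (rule DERIV_imp_deriv)
    qed
    show ?thesis
    proof (rule le_of_le_add_inverse_nat)
      fix k :: nat assume k: "0 < k"
      have "norm (F (of_real x)) \<le> T * ((\<Sum>j<k. (norm (G (of_real (node j / T)))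
          + norm (G (of_real (- (node j / T))))) / (node j)\<^sup>2) + 8 * max C (1 + I) / (real k * pi))"
        unfolding dG[symmetric]
        by (rule norm_deriv_le_scaled_node_sum[OF holG growth axis]) (use \<sigma> k in \<open>auto simp: T_def\<close>)
      also have "\<dots> \<le> T * (2 * (1 + I) * W + 8 * max C (1 + I) / (real k * pi))"
      proof (intro mult_left_mono add_mono order_refl)
        have "(\<Sum>j<k. (norm (G (of_real (node j / T))) + norm (G (of_real (- (node j / T))))) / (node j)\<^sup>2)
            \<le> (\<Sum>j<k. 2 * (1 + I) * (1 / (node j)\<^sup>2))"
        proof (rule sum_mono)
          fix j
          have "norm (G (of_real (node j / T))) + norm (G (of_real (- (node j / T)))) \<le> 2 * (1 + I)"
            unfolding mult_2 by (intro add_mono axis)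
          then show "(norm (G (of_real (node j / T))) + norm (G (of_real (- (node j / T))))) / (node j)\<^sup>2
              \<le> 2 * (1 + I) * (1 / (node j)\<^sup>2)"
            by (simp add: divide_right_mono)
        qed
        also have "\<dots> \<le> 2 * (1 + I) * W"
          unfolding sum_distrib_left[symmetric] W_def using I0
          by (intro mult_left_mono sum_le_suminf summable_node) auto
        finally show "(\<Sum>j<k. (norm (G (of_real (node j / T))) + norm (G (of_real (- (node j / T))))) / (node j)\<^sup>2)
            \<le> 2 * (1 + I) * W" .
        show "0 \<le> T" using \<sigma> by (simp add: T_def)
      qed
      finally show "norm (F (of_real x)) \<le> T * (2 * (1 + I) * W) + (T * 8 * max C (1 + I) / pi) / real k"
        by (simp add: distrib_left mult_ac)
    qed
  qed
  then show ?thesis by (rule that)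
qed

section \<open>The pointwise estimate\<close>

context beurling_weight
begin

text \<open>Twice the type of \<open>f z * h z\<close>, for a multiplier \<open>h\<close> and a function \<open>f\<close> with
\<open>\<bar>f z\<bar> \<le> C * exp (2 * norm z)\<close>: this is the scale required by \<open>norm_deriv_le_scaled_node_sum\<close>.\<close>

definition bandwidth :: real where
  "bandwidth = 2 * (2 + mult_type)"

lemma bandwidth_pos: "0 < bandwidth"
  using mult_type_nonneg by (simp add: bandwidth_def)

definition shift :: "nat \<Rightarrow> real" where
  "shift j = node j / bandwidth"

lemma shift_pos: "0 < shift j"
  using bandwidth_pos node_pos by (simp add: shift_def)

definition damped_shifts :: "(real \<Rightarrow> complex) \<Rightarrow> real \<Rightarrow> nat \<Rightarrow> real \<Rightarrow> real" where
  "damped_shifts f \<sigma> j x = (norm (f (x + shift j / \<sigma>)) + norm (f (x - shift j / \<sigma>))) / \<mu> (shift j)"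

text \<open>The interpolation bound for \<open>G z = F (x + z) * h (\<sigma> * z)\<close>, where the nodes sit at \<open>\<plusminus> shift j / \<sigma>\<close> and
the multiplier contributes at most \<open>\<mu> 1 / \<mu> (shift j)\<close>. For the first \<open>k\<close> nodes a truncated
multiplier is enough. It depends on \<open>k\<close>, but the bounds for \<open>G\<close> do not, so the error term still vanishes
as \<open>k\<close> grows.\<close>

lemma pointwise_bernstein:
  assumes F: "exponential_type \<sigma> F" and \<sigma>: "1 \<le> \<sigma>"
    and bdd: "\<And>x. norm (F (of_real x)) \<le> S"
  shows "summable (\<lambda>j. 1 / (node j)\<^sup>2 * damped_shifts (\<lambda>x. F (of_real x)) \<sigma> j x)"
    and "norm (deriv F (of_real x))
      \<le> \<sigma> * bandwidth * \<mu> 1 * (\<Sum>j. 1 / (node j)\<^sup>2 * damped_shifts (\<lambda>x. F (of_real x)) \<sigma> j x)"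
proof -
  let ?g = "damped_shifts (\<lambda>x. F (of_real x)) \<sigma>"
  have hol: "F holomorphic_on UNIV" using F by (simp add: exponential_type_def)
  have S0: "0 \<le> S" using bdd norm_ge_zero order_trans by blast
  have g0: "0 \<le> ?g j x" for j
    using pos by (simp add: damped_shifts_def less_imp_le)
  have g1: "?g j x \<le> 2 * S" for j
  proof -
    have "?g j x \<le> 2 * S / 1"
      unfolding damped_shifts_def using S0 ge_1 bdd[of "x + shift j / \<sigma>"] bdd[of "x - shift j / \<sigma>"]
      by (intro frac_le) auto
    then show ?thesis by simp
  qed
  show sm: "summable (\<lambda>j. 1 / (node j)\<^sup>2 * ?g j x)"
  proof (rule summable_comparison_test)
    show "summable (\<lambda>j. 1 / (node j)\<^sup>2 * (2 * S))"
      by (intro summable_mult2 summable_node)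
    show "\<exists>n0. \<forall>j\<ge>n0. norm (1 / (node j)\<^sup>2 * ?g j x) \<le> 1 / (node j)\<^sup>2 * (2 * S)"
      using g0 g1 by (auto simp: abs_mult intro!: divide_right_mono)
  qed
  obtain C where C: "0 < C" "\<And>z. norm (F (of_real x + z)) \<le> C * exp (2 * \<sigma> * norm z)"
    using exponential_type_translate[OF F] \<sigma> by (metis less_le_trans zero_less_one)
  define T where "T = \<sigma> * bandwidth"
  have T: "0 < T" using \<sigma> bandwidth_pos by (simp add: T_def)
  show "norm (deriv F (of_real x)) \<le> \<sigma> * bandwidth * \<mu> 1 * (\<Sum>j. 1 / (node j)\<^sup>2 * ?g j x)"
  proof (rule le_of_le_add_inverse_nat)
    fix k :: nat assume k: "0 < k"
    \<comment> \<open>enough blocks for \<open>multiplier_decay\<close> to hold at the first \<open>k\<close> nodes\<close>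
    obtain M where M: "shift k < 2 ^ M"
      using real_arch_pow[of 2 "shift k"] by auto
    have shift_lt: "\<bar>shift j\<bar> < 2 ^ M" if "j < k" for j
    proof -
      have "shift j \<le> shift k"
        unfolding shift_def node_def using that bandwidth_pos
        by (intro divide_right_mono mult_right_mono) auto
      then show ?thesis using M shift_pos[of j] by linarith
    qed
    define h where "h = multiplier mult_exponent M"
    define G where "G z = F (of_real x + z) * h (of_real \<sigma> * z)" for z
    have holFx: "(\<lambda>z. F (of_real x + z)) holomorphic_on UNIV"
      using entire_affine[OF hol, of "of_real x" 1] by simp
    have holh: "(\<lambda>z. h (of_real \<sigma> * z)) holomorphic_on UNIV"
      using entire_affine[OF holomorphic_multiplier, where a=0] by (simp add: h_def)
    have holG: "G holomorphic_on UNIV"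
      unfolding G_def using holFx holh by (intro holomorphic_intros)
    have growth: "norm (G z) \<le> C * exp (\<sigma> * (2 + mult_type) * norm z)" for z
    proof -
      have "norm (h (of_real \<sigma> * z)) \<le> exp (mult_type * (\<sigma> * norm z))"
        using multiplier_growth[of M "of_real \<sigma> * z"] \<sigma> by (simp add: h_def norm_mult)
      then have "norm (G z) \<le> C * exp (2 * \<sigma> * norm z) * exp (mult_type * (\<sigma> * norm z))"
        unfolding G_def norm_mult using C by (intro mult_mono) auto
      then show ?thesis
        by (simp add: algebra_simps exp_add)
    qed
    have axis: "norm (G (of_real t)) \<le> S" for t
    proof -
      have "norm (G (of_real t)) \<le> S * 1"
        unfolding G_def norm_mult h_def
        using bdd[of "x + t"] norm_multiplier_real_le_1[of _ M "\<sigma> * t"] S0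
        by (intro mult_mono) auto
      then show ?thesis by simp
    qed
    have dG: "deriv G 0 = deriv F (of_real x)"
    proof -
      have "((\<lambda>z. F (of_real x + z)) has_field_derivative deriv F (of_real x)) (at 0)"
        using holomorphic_derivI[OF holFx, of 0] deriv_entire_affine[OF hol, of "of_real x" 1] by simp
      moreover have "((\<lambda>z. h (of_real \<sigma> * z)) has_field_derivative 0) (at 0)"
        using holomorphic_derivI[OF holh, of 0]
          deriv_entire_affine[OF holomorphic_multiplier[of mult_exponent M], of 0 "of_real \<sigma>"]
        by (simp add: h_def deriv_multiplier_0)
      ultimately have "(G has_field_derivative deriv F (of_real x)) (at 0)"
        unfolding G_def by (auto intro!: derivative_eq_intros simp: h_def)
      then show ?thesis by (rule DERIV_imp_deriv)
    qed
    have "norm (deriv F (of_real x)) \<le> T * ((\<Sum>j<k. (norm (G (of_real (node j / T)))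
          + norm (G (of_real (- (node j / T))))) / (node j)\<^sup>2) + 8 * max C S / (real k * pi))"
      unfolding dG[symmetric]
      by (rule norm_deriv_le_scaled_node_sum[OF holG growth axis T])
        (use k in \<open>auto simp: T_def bandwidth_def algebra_simps\<close>)
    also have "\<dots> \<le> T * (\<mu> 1 * (\<Sum>j. 1 / (node j)\<^sup>2 * ?g j x) + 8 * max C S / (real k * pi))"
    proof (intro mult_left_mono add_mono order_refl)
      have node_T: "node j / T = shift j / \<sigma>" for j
        by (simp add: T_def shift_def)
      have "(\<Sum>j<k. (norm (G (of_real (node j / T))) + norm (G (of_real (- (node j / T))))) / (node j)\<^sup>2)
          \<le> (\<Sum>j<k. \<mu> 1 * (1 / (node j)\<^sup>2 * ?g j x))"
      proof (rule sum_mono)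
        fix j assume "j \<in> {..<k}"
        then have "norm (h (of_real (shift j))) \<le> \<mu> 1 / \<mu> (shift j)"
          "norm (h (of_real (- shift j))) \<le> \<mu> 1 / \<mu> (- shift j)"
          unfolding h_def using shift_lt[of j] shift_pos[of j]
          by (intro multiplier_decay; force)+
        then have "norm (F (of_real (x + shift j / \<sigma>))) * norm (h (of_real (shift j)))
            + norm (F (of_real (x - shift j / \<sigma>))) * norm (h (of_real (- shift j)))
            \<le> norm (F (of_real (x + shift j / \<sigma>))) * (\<mu> 1 / \<mu> (shift j))
            + norm (F (of_real (x - shift j / \<sigma>))) * (\<mu> 1 / \<mu> (shift j))"
          unfolding even by (intro add_mono mult_left_mono) auto
        also have "\<dots> = \<mu> 1 * ?g j x"
          by (simp add: damped_shifts_def add_divide_distrib distrib_left mult_ac)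
        finally have "norm (G (of_real (node j / T))) + norm (G (of_real (- (node j / T)))) \<le> \<mu> 1 * ?g j x"
          using \<sigma> unfolding node_T by (simp add: G_def norm_mult)
        then show "(norm (G (of_real (node j / T))) + norm (G (of_real (- (node j / T))))) / (node j)\<^sup>2
            \<le> \<mu> 1 * (1 / (node j)\<^sup>2 * ?g j x)"
          by (simp add: divide_right_mono)
      qed
      also have "\<dots> \<le> \<mu> 1 * (\<Sum>j. 1 / (node j)\<^sup>2 * ?g j x)"
        unfolding sum_distrib_left[symmetric] using pos g0
        by (intro mult_left_mono sum_le_suminf sm) (auto simp: less_imp_le)
      finally show "(\<Sum>j<k. (norm (G (of_real (node j / T))) + norm (G (of_real (- (node j / T))))) / (node j)\<^sup>2)
          \<le> \<mu> 1 * (\<Sum>j. 1 / (node j)\<^sup>2 * ?g j x)" .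
      show "0 \<le> T" using T by simp
    qed
    finally show "norm (deriv F (of_real x))
        \<le> \<sigma> * bandwidth * \<mu> 1 * (\<Sum>j. 1 / (node j)\<^sup>2 * ?g j x) + (T * 8 * max C S / pi) / real k"
      by (simp add: distrib_left mult_ac T_def)
  qed
qed

end

section \<open>The norm estimate\<close>

lemma exponential_type_deriv:
  assumes F: "exponential_type \<sigma> F" and \<sigma>: "0 \<le> \<sigma>"
  shows "exponential_type \<sigma> (deriv F)"
  unfolding exponential_type_def
proof (intro conjI allI impI)
  have hol: "F holomorphic_on UNIV" using F by (simp add: exponential_type_def)
  then show "deriv F holomorphic_on UNIV" by (intro holomorphic_deriv) auto
  fix \<epsilon> :: real assume \<epsilon>: "0 < \<epsilon>"
  then obtain C where C: "0 < C" "\<And>z. norm (F z) \<le> C * exp ((\<sigma> + \<epsilon>) * norm z)"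
    using F unfolding exponential_type_def by blast
  have "norm (deriv F z) \<le> C * exp (\<sigma> + \<epsilon>) * exp ((\<sigma> + \<epsilon>) * norm z)" for z
  proof -
    have "norm ((deriv ^^ 1) F z) \<le> fact 1 * (C * exp ((\<sigma> + \<epsilon>) * (1 + norm z))) / 1 ^ 1"
    proof (rule Cauchy_inequality)
      show "F holomorphic_on ball z 1" "continuous_on (cball z 1) F"
        using hol holomorphic_on_subset holomorphic_on_imp_continuous_on by blast+
      fix w assume w: "norm (z - w) = 1"
      have "norm w \<le> 1 + norm z"
        using norm_triangle_sub[of w z] w by (simp add: norm_minus_commute)
      then have "C * exp ((\<sigma> + \<epsilon>) * norm w) \<le> C * exp ((\<sigma> + \<epsilon>) * (1 + norm z))"
        using C(1) \<sigma> \<epsilon> by (intro mult_left_mono) (auto intro: mult_left_mono)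
      then show "norm (F w) \<le> C * exp ((\<sigma> + \<epsilon>) * (1 + norm z))"
        using C(2) order_trans by blast
    qed simp
    then show ?thesis
      by (simp add: ring_distribs exp_add mult_ac)
  qed
  then show "\<exists>C>0. \<forall>z. norm (deriv F z) \<le> C * exp ((\<sigma> + \<epsilon>) * norm z)"
    using C(1) by (intro exI[of _ "C * exp (\<sigma> + \<epsilon>)"]) auto
qed

lemma continuous_imp_lebesgue_measurable:
  fixes g :: "real \<Rightarrow> 'a::topological_space"
  assumes "continuous_on UNIV g"
  shows "g \<in> borel_measurable lebesgue"
  using borel_measurable_continuous_onI[OF assms]
  by (intro measurable_completion) (simp add: measurable_lborel1)

lemma vector_derivative_of_real_comp:
  assumes "F holomorphic_on UNIV"
  shows "vector_derivative (\<lambda>x. F (of_real x)) (at t) = deriv F (of_real t)"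
proof (intro vector_derivative_at has_vector_derivative_real_field)
  show "(F has_field_derivative deriv F (of_real t)) (at (of_real t))"
    using assms by (auto intro!: holomorphic_derivI[where S=UNIV])
qed

text \<open>The power mean inequality for series. With \<open>m\<close> the weighted mean of \<open>g\<close>, it is the sum over \<open>j\<close> of
Young's inequality \<open>g j * m powr (p - 1) \<le> g j powr p / p + (1 - 1 / p) * m powr p\<close>.\<close>

lemma powr_suminf_le:
  fixes w g :: "nat \<Rightarrow> real"
  assumes p: "1 \<le> p" and w: "\<And>j. 0 \<le> w j" and g: "\<And>j. 0 \<le> g j"
    and sw: "summable w" and swg: "summable (\<lambda>j. w j * g j)"
    and swgp: "summable (\<lambda>j. w j * g j powr p)"
  shows "(\<Sum>j. w j * g j) powr p \<le> (\<Sum>j. w j) powr (p - 1) * (\<Sum>j. w j * g j powr p)"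
proof (cases "(\<Sum>j. w j * g j) = 0")
  case True
  then show ?thesis
    using p w g by (simp add: suminf_nonneg swgp)
next
  case False
  define W where "W = (\<Sum>j. w j)"
  have pos: "0 < (\<Sum>j. w j * g j)"
    using False w g suminf_nonneg[OF swg] by simp
  have W0: "0 < W"
  proof (rule ccontr)
    assume "\<not> 0 < W"
    then have "W = 0"
      using suminf_nonneg[OF sw] w by (simp add: W_def)
    then have "\<forall>j. w j = 0"
      using suminf_eq_zero_iff[OF sw] w by (simp add: W_def)
    then show False using False by simp
  qed
  define m where "m = (\<Sum>j. w j * g j) / W"
  have m0: "0 < m" using pos W0 by (simp add: m_def)
  have young: "a * m powr (p - 1) \<le> 1 / p * a powr p + (1 - 1 / p) * m powr p" if "0 \<le> a" for a
  proof (cases "a = 0")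
    case True
    then show ?thesis using p by simp
  next
    case False
    have "(a powr p) powr (1 / p) * (m powr p) powr (1 - 1 / p) \<le> 1 / p * a powr p + (1 - 1 / p) * m powr p"
      using p m0 that False by (intro Youngs_inequality_0) auto
    moreover have "p * (1 - 1 / p) = p - 1" using p by (simp add: field_simps)
    ultimately show ?thesis
      using p m0 that False by (simp add: powr_powr)
  qed
  have "m powr p * W = m powr (p - 1) * (m * W)"
    using m0 by (simp add: powr_diff)
  also have "\<dots> = (\<Sum>j. w j * g j) * m powr (p - 1)"
    using W0 by (simp add: m_def)
  also have "\<dots> = (\<Sum>j. w j * g j * m powr (p - 1))"
    by (rule suminf_mult2[OF swg])
  also have "\<dots> \<le> (\<Sum>j. 1 / p * (w j * g j powr p) + (1 - 1 / p) * m powr p * w j)"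
  proof (rule suminf_le)
    show "w j * g j * m powr (p - 1) \<le> 1 / p * (w j * g j powr p) + (1 - 1 / p) * m powr p * w j" for j
      using mult_left_mono[OF young[OF g] w, of j j] by (simp add: algebra_simps)
  qed (intro summable_mult2 summable_mult summable_add swg swgp sw)+
  also have "\<dots> = 1 / p * (\<Sum>j. w j * g j powr p) + (1 - 1 / p) * m powr p * W"
    unfolding W_def
    by (subst suminf_add[symmetric] suminf_mult, (intro summable_mult swgp sw)+)+ (rule refl)
  finally have "1 / p * (m powr p * W) \<le> 1 / p * (\<Sum>j. w j * g j powr p)"
    by (simp add: algebra_simps)
  then have "m powr p * W \<le> (\<Sum>j. w j * g j powr p)"
    using p by (simp add: field_simps)
  then have "W powr (p - 1) * (m powr p * W) \<le> W powr (p - 1) * (\<Sum>j. w j * g j powr p)"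
    by (intro mult_left_mono) auto
  moreover have "(\<Sum>j. w j * g j) powr p = W powr (p - 1) * (m powr p * W)"
  proof -
    have "(\<Sum>j. w j * g j) = m * W" using W0 by (simp add: m_def)
    moreover have "W powr p = W powr (p - 1) * W" using W0 by (simp add: powr_diff)
    ultimately show ?thesis using m0 W0 by (simp add: powr_mult mult_ac)
  qed
  ultimately show ?thesis by (simp add: W_def)
qed

lemma powr_add_le:
  assumes "0 \<le> a" "0 \<le> b" "0 \<le> (p::real)"
  shows "(a + b) powr p \<le> 2 powr p * (a powr p + b powr p)"
proof -
  have "(a + b) powr p \<le> (2 * max a b) powr p"
    using assms by (intro powr_mono2) auto
  also have "\<dots> = 2 powr p * max a b powr p"
    using assms by (intro powr_mult)
  also have "\<dots> \<le> 2 powr p * (a powr p + b powr p)"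
    by (intro mult_left_mono) (auto simp: max_def)
  finally show ?thesis .
qed

locale submultiplicative_beurling_weight = beurling_weight +
  assumes submult: "\<mu> (t + s) \<le> \<mu> t * \<mu> s"
begin

text \<open>The weight is recovered from its logarithmic integrand, which is measurable as an integrable function.\<close>

lemma measurable_weight: "\<mu> \<in> borel_measurable lebesgue"
proof -
  have [measurable]: "(\<lambda>t::real. 1 + t\<^sup>2) \<in> borel_measurable lebesgue"
    by (intro continuous_imp_lebesgue_measurable continuous_intros)
  have [measurable]: "(\<lambda>t. ln (\<mu> t) / (1 + t\<^sup>2)) \<in> borel_measurable lebesgue"
    using log_integrable by (rule borel_measurable_integrable)
  have "(\<lambda>t. exp (ln (\<mu> t) / (1 + t\<^sup>2) * (1 + t\<^sup>2))) \<in> borel_measurable lebesgue"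
    by measurable
  moreover have "(\<lambda>t. exp (ln (\<mu> t) / (1 + t\<^sup>2) * (1 + t\<^sup>2))) = \<mu>"
  proof
    fix t :: real
    have "1 + t\<^sup>2 \<noteq> 0" using zero_le_power2[of t] by linarith
    then show "exp (ln (\<mu> t) / (1 + t\<^sup>2) * (1 + t\<^sup>2)) = \<mu> t"
      using pos[of t] by simp
  qed
  ultimately show ?thesis by simp
qed

lemma translation_bound:
  assumes f: "f \<in> borel_measurable lebesgue" and p: "0 \<le> p"
    and t: "t \<noteq> 0" "\<bar>t\<bar> \<le> s"
  shows "(\<integral>\<^sup>+x. ennreal ((norm (f (x + t)) / \<mu> s) powr p * \<mu> x powr p) \<partial>lebesgue)
    \<le> (\<integral>\<^sup>+x. ennreal (norm (f x :: complex) powr p * \<mu> x powr p) \<partial>lebesgue)"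
proof -
  have [measurable]: "f \<in> borel_measurable lebesgue" "\<mu> \<in> borel_measurable lebesgue"
    using f measurable_weight by auto
  have "(\<integral>\<^sup>+x. ennreal ((norm (f (x + t)) / \<mu> s) powr p * \<mu> x powr p) \<partial>lebesgue)
    \<le> (\<integral>\<^sup>+x. ennreal (norm (f (t + 1 * x)) powr p * \<mu> (t + 1 * x) powr p) \<partial>lebesgue)"
  proof (rule nn_integral_mono, rule ennreal_leI)
    fix x
    have "\<mu> x = \<mu> ((x + t) + - t)" by simp
    also have "\<dots> \<le> \<mu> (x + t) * \<mu> (- t)" by (rule submult)
    also have "\<dots> \<le> \<mu> (x + t) * \<mu> s"
      using t pos[of "x + t"] by (intro mult_left_mono mono_abs) auto
    finally have "\<mu> x / \<mu> s \<le> \<mu> (x + t)"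
      using pos[of s] by (simp add: field_simps)
    then have "norm (f (x + t)) * (\<mu> x / \<mu> s) \<le> norm (f (x + t)) * \<mu> (x + t)"
      by (intro mult_left_mono) auto
    then have "(norm (f (x + t)) / \<mu> s * \<mu> x) powr p \<le> (norm (f (x + t)) * \<mu> (x + t)) powr p"
      using pos p by (intro powr_mono2) (auto simp: less_imp_le)
    moreover have "(norm (f (x + t)) / \<mu> s) powr p * \<mu> x powr p = (norm (f (x + t)) / \<mu> s * \<mu> x) powr p"
      "norm (f (x + t)) powr p * \<mu> (x + t) powr p = (norm (f (x + t)) * \<mu> (x + t)) powr p"
      using pos by (intro powr_mult[symmetric]; simp add: less_imp_le)+
    ultimately show "(norm (f (x + t)) / \<mu> s) powr p * \<mu> x powr p
        \<le> norm (f (t + 1 * x)) powr p * \<mu> (t + 1 * x) powr p"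
      by (simp only: mult_1 add.commute[of t])
  qed
  also have "\<dots> = (\<integral>\<^sup>+x. ennreal (norm (f x) powr p * \<mu> x powr p) \<partial>lebesgue)"
    by (subst nn_integral_real_affine_lebesgue[of _ 1 t]) auto
  finally show ?thesis .
qed

text \<open>The product of the scale \<open>bandwidth\<close>, the loss \<open>\<mu> 1\<close> of the multiplier, the total mass of the coefficients, and
the factor \<open>2 powr ((p + 1) / p)\<close> from combining the translates to the left and to the right.\<close>

definition bernstein_const :: "real \<Rightarrow> real" where
  "bernstein_const p = bandwidth * \<mu> 1 * (\<Sum>j. 1 / (node j)\<^sup>2) * 2 powr ((p + 1) / p)"

lemma suminf_node_pos: "0 < (\<Sum>j. 1 / (node j)\<^sup>2)"
  by (intro suminf_pos summable_node divide_pos_pos zero_less_power node_pos) simp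

lemma bernstein_const_pos: "0 < bernstein_const p"
  using bandwidth_pos pos suminf_node_pos by (simp add: bernstein_const_def)

text \<open>The \<open>p\<close>-th power of the pointwise bound is estimated by the power mean inequality and integrated term by
term. By \<open>translation_bound\<close> every term contributes at most \<open>2 powr (p + 1)\<close> times the integral for \<open>f\<close>:
\<open>2 powr p\<close> from \<open>powr_add_le\<close> and another \<open>2\<close> from the two translates. Working with nonnegative integrals
yields the integrability of the derivative at the same time.\<close>

lemma bernstein_first_derivative:
  assumes p: "1 \<le> p" and \<sigma>: "1 \<le> \<sigma>" and f: "f \<in> Lp_weighted p \<mu> \<inter> B_type \<sigma>"
  shows "(\<lambda>t. vector_derivative f (at t)) \<in> Lp_weighted p \<mu> \<inter> B_type \<sigma>"
    and "Lp_weighted_norm p \<mu> (\<lambda>t. vector_derivative f (at t))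
      \<le> bernstein_const p * \<sigma> * Lp_weighted_norm p \<mu> f"
proof -
  obtain F where F: "exponential_type \<sigma> F" and fF: "f = (\<lambda>x. F (of_real x))"
    using f by (auto simp: B_type_def)
  have hol: "F holomorphic_on UNIV" using F by (simp add: exponential_type_def)
  have f': "(\<lambda>t. vector_derivative f (at t)) = (\<lambda>t. deriv F (of_real t))"
    unfolding fF using vector_derivative_of_real_comp[OF hol] by auto
  have F': "exponential_type \<sigma> (deriv F)"
    using exponential_type_deriv[OF F] \<sigma> by simp
  have [measurable]: "f \<in> borel_measurable lebesgue" "\<mu> \<in> borel_measurable lebesgue"
    using f measurable_weight by (auto simp: Lp_weighted_def)
  have contF': "continuous_on UNIV (\<lambda>t. deriv F (complex_of_real t))"
    using F' holomorphic_on_imp_continuous_on unfolding exponential_type_def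
    by (intro continuous_on_compose2[OF _ continuous_on_of_real]) (auto intro: continuous_on_id)
  have [measurable]: "(\<lambda>t. deriv F (complex_of_real t)) \<in> borel_measurable lebesgue"
    using contF' by (rule continuous_imp_lebesgue_measurable)
  have shift_measurable [measurable]: "(\<lambda>x. f (x + c)) \<in> borel_measurable lebesgue" for c
    unfolding fF using holomorphic_on_imp_continuous_on[OF hol]
    by (intro continuous_imp_lebesgue_measurable) (auto intro!: continuous_on_compose2[of UNIV F] continuous_intros)
  have [measurable]: "damped_shifts f \<sigma> j \<in> borel_measurable lebesgue" for j
    unfolding damped_shifts_def diff_conv_add_uminus by measurable
  define I where "I = (LINT s|lebesgue. norm (f s) powr p * \<mu> s powr p)"
  have intf: "integrable lebesgue (\<lambda>s. norm (f s) powr p * \<mu> s powr p)"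
    using f by (simp add: Lp_weighted_def)
  have I0: "0 \<le> I" unfolding I_def by (intro integral_nonneg_AE) auto
  have nnI: "(\<integral>\<^sup>+s. ennreal (norm (f s) powr p * \<mu> s powr p) \<partial>lebesgue) = ennreal I"
    unfolding I_def using intf by (intro nn_integral_eq_integral) auto
  have "integrable lebesgue (\<lambda>s. norm (F (of_real s)) powr p)"
  proof (rule Bochner_Integration.integrable_bound[OF intf])
    show "(\<lambda>s. norm (F (of_real s)) powr p) \<in> borel_measurable lebesgue"
      unfolding fF[THEN fun_cong, symmetric] by measurable
    have "norm (f s) powr p * 1 \<le> norm (f s) powr p * \<mu> s powr p" for s
      using ge_1[of s] p by (intro mult_left_mono ge_one_powr_ge_zero) auto
    then show "AE s in lebesgue. norm (norm (F (of_real s)) powr p) \<le> norm (norm (f s) powr p * \<mu> s powr p)"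
      by (simp add: fF)
  qed
  then obtain S where S: "\<And>x. norm (F (of_real x)) \<le> S"
    using bounded_on_real_line[OF F _ p] \<sigma> by (metis less_le_trans zero_less_one)
  define w where "w j = 1 / (node j)\<^sup>2" for j
  define W where "W = (\<Sum>j. w j)"
  have sw: "summable w" unfolding w_def by (rule summable_node)
  have w0: "0 \<le> w j" for j by (simp add: w_def)
  have W0: "0 < W" unfolding W_def w_def by (rule suminf_node_pos)
  define A where "A = \<sigma> * bandwidth * \<mu> 1"
  have A0: "0 < A" using \<sigma> bandwidth_pos pos by (simp add: A_def)
  let ?g = "damped_shifts f \<sigma>"
  have g0: "0 \<le> ?g j x" for j x
    using pos by (simp add: damped_shifts_def less_imp_le)
  have S0: "0 \<le> S" using S norm_ge_zero order_trans by blast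
  have g1: "?g j x \<le> 2 * S" for j x
  proof -
    have "?g j x \<le> 2 * S / 1"
      unfolding damped_shifts_def fF using S0 ge_1 S[of "x + shift j / \<sigma>"] S[of "x - shift j / \<sigma>"]
      by (intro frac_le) auto
    then show ?thesis by simp
  qed
  have sgp: "summable (\<lambda>j. w j * ?g j x powr p)" for x
  proof (rule summable_comparison_test)
    show "summable (\<lambda>j. w j * (2 * S) powr p)" by (intro summable_mult2 sw)
    show "\<exists>n0. \<forall>j\<ge>n0. norm (w j * ?g j x powr p) \<le> w j * (2 * S) powr p"
      using g0 g1 w0 p by (auto simp: abs_mult intro!: mult_left_mono powr_mono2)
  qed
  have pointwise: "norm (deriv F (of_real x)) powr p
      \<le> A powr p * W powr (p - 1) * (\<Sum>j. w j * ?g j x powr p)" for x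
  proof -
    note pb = pointwise_bernstein[OF F \<sigma> S, of x, folded fF w_def A_def]
    have "norm (deriv F (of_real x)) powr p \<le> (A * (\<Sum>j. w j * ?g j x)) powr p"
      using pb(2) p by (intro powr_mono2) auto
    also have "\<dots> = A powr p * (\<Sum>j. w j * ?g j x) powr p"
      by (rule powr_mult)
    also have "\<dots> \<le> A powr p * (W powr (p - 1) * (\<Sum>j. w j * ?g j x powr p))"
      unfolding W_def by (intro mult_left_mono powr_suminf_le p w0 g0 sw pb(1) sgp powr_ge_zero)
    finally show ?thesis by (simp add: mult.assoc)
  qed
  have shift_int: "(\<integral>\<^sup>+x. ennreal (?g j x powr p * \<mu> x powr p) \<partial>lebesgue) \<le> ennreal (2 powr p * (2 * I))" for j
  proof -
    define t where "t = shift j / \<sigma>"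
    have t: "0 < t" "t \<le> shift j"
      using shift_pos[of j] \<sigma> by (auto simp: t_def field_simps)
    let ?u = "\<lambda>c x. (norm (f (x + c)) / \<mu> (shift j)) powr p * \<mu> x powr p"
    have "?g j x powr p * \<mu> x powr p \<le> 2 powr p * (?u t x + ?u (- t) x)" for x
    proof -
      have "?g j x powr p \<le> 2 powr p * ((norm (f (x + t)) / \<mu> (shift j)) powr p
          + (norm (f (x + - t)) / \<mu> (shift j)) powr p)"
        unfolding damped_shifts_def t_def[symmetric] add_divide_distrib diff_conv_add_uminus
        using p pos by (intro powr_add_le) (auto simp: less_imp_le)
      then have "?g j x powr p * \<mu> x powr p \<le> 2 powr p * ((norm (f (x + t)) / \<mu> (shift j)) powr p
          + (norm (f (x + - t)) / \<mu> (shift j)) powr p) * \<mu> x powr p"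
        by (intro mult_right_mono) auto
      then show ?thesis by (simp add: distrib_left distrib_right mult.assoc)
    qed
    then have "(\<integral>\<^sup>+x. ennreal (?g j x powr p * \<mu> x powr p) \<partial>lebesgue)
        \<le> (\<integral>\<^sup>+x. ennreal (2 powr p) * (ennreal (?u t x) + ennreal (?u (- t) x)) \<partial>lebesgue)"
      by (intro nn_integral_mono) (simp flip: ennreal_plus ennreal_mult)
    also have "\<dots> = ennreal (2 powr p) * ((\<integral>\<^sup>+x. ennreal (?u t x) \<partial>lebesgue) + (\<integral>\<^sup>+x. ennreal (?u (- t) x) \<partial>lebesgue))"
      by (subst nn_integral_cmult, measurable, subst nn_integral_add, measurable)
    also have "\<dots> \<le> ennreal (2 powr p) * (ennreal I + ennreal I)"
      using t p translation_bound[of f p t "shift j"] translation_bound[of f p "- t" "shift j"]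
      unfolding nnI by (intro mult_left_mono add_mono) auto
    also have "\<dots> = ennreal (2 powr p * (2 * I))"
      using I0 by (simp add: ennreal_mult flip: ennreal_plus)
    finally show ?thesis .
  qed
  define K where "K = A powr p * W powr (p - 1)"
  have K0: "0 \<le> K" by (simp add: K_def)
  define J where "J = A powr p * W powr p * 2 powr (p + 1) * I"
  have J0: "0 \<le> J" using I0 by (simp add: J_def)
  have total: "(\<integral>\<^sup>+x. ennreal (norm (deriv F (of_real x)) powr p * \<mu> x powr p) \<partial>lebesgue) \<le> ennreal J"
  proof -
    have "(\<integral>\<^sup>+x. ennreal (norm (deriv F (of_real x)) powr p * \<mu> x powr p) \<partial>lebesgue)
        \<le> (\<integral>\<^sup>+x. (\<Sum>j. ennreal (K * w j * (?g j x powr p * \<mu> x powr p))) \<partial>lebesgue)"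
    proof (rule nn_integral_mono)
      fix x
      have "norm (deriv F (of_real x)) powr p * \<mu> x powr p
          \<le> K * (\<Sum>j. w j * ?g j x powr p) * \<mu> x powr p"
        using pointwise[of x] by (intro mult_right_mono) (auto simp: K_def)
      also have "\<dots> = (\<Sum>j. K * w j * (?g j x powr p * \<mu> x powr p))"
        using suminf_mult[OF sgp[of x], of "K * \<mu> x powr p"] by (simp add: mult_ac)
      finally have "ennreal (norm (deriv F (of_real x)) powr p * \<mu> x powr p)
          \<le> ennreal (\<Sum>j. K * w j * (?g j x powr p * \<mu> x powr p))"
        by (rule ennreal_leI)
      also have "\<dots> = (\<Sum>j. ennreal (K * w j * (?g j x powr p * \<mu> x powr p)))"
      proof (rule suminf_ennreal2[symmetric])
        show "summable (\<lambda>j. K * w j * (?g j x powr p * \<mu> x powr p))"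
          using summable_mult[OF sgp[of x], of "K * \<mu> x powr p"] by (simp add: mult_ac)
      qed (use K0 w0 in auto)
      finally show "ennreal (norm (deriv F (of_real x)) powr p * \<mu> x powr p)
          \<le> (\<Sum>j. ennreal (K * w j * (?g j x powr p * \<mu> x powr p)))" .
    qed
    also have "\<dots> = (\<Sum>j. \<integral>\<^sup>+x. ennreal (K * w j * (?g j x powr p * \<mu> x powr p)) \<partial>lebesgue)"
    proof (rule nn_integral_suminf)
      fix j
      show "(\<lambda>x. ennreal (K * w j * (?g j x powr p * \<mu> x powr p))) \<in> borel_measurable lebesgue"
        by measurable
    qed
    also have "\<dots> \<le> (\<Sum>j. ennreal (K * w j * (2 powr p * (2 * I))))"
    proof (rule suminf_le)
      fix j
      have "(\<integral>\<^sup>+x. ennreal (K * w j * (?g j x powr p * \<mu> x powr p)) \<partial>lebesgue)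
          = ennreal (K * w j) * (\<integral>\<^sup>+x. ennreal (?g j x powr p * \<mu> x powr p) \<partial>lebesgue)"
        using K0 w0 by (simp add: ennreal_mult nn_integral_cmult)
      also have "\<dots> \<le> ennreal (K * w j) * ennreal (2 powr p * (2 * I))"
        by (intro mult_left_mono shift_int) auto
      finally show "(\<integral>\<^sup>+x. ennreal (K * w j * (?g j x powr p * \<mu> x powr p)) \<partial>lebesgue)
          \<le> ennreal (K * w j * (2 powr p * (2 * I)))"
        using K0 w0 I0 by (simp add: ennreal_mult)
    qed auto
    also have "\<dots> = ennreal (\<Sum>j. K * w j * (2 powr p * (2 * I)))"
      using K0 w0 I0 by (intro suminf_ennreal2 summable_mult2 summable_mult sw) auto
    also have "(\<Sum>j. K * w j * (2 powr p * (2 * I))) = J"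
    proof -
      have "(\<Sum>j. K * w j * (2 powr p * (2 * I))) = K * W * (2 powr p * (2 * I))"
        unfolding W_def using sw by (simp add: suminf_mult suminf_mult2[symmetric] summable_mult)
      moreover have "W powr p = W powr (p - 1) * W" using W0 by (simp add: powr_diff)
      ultimately show ?thesis by (simp add: J_def K_def powr_add mult_ac)
    qed
    finally show ?thesis .
  qed
  have intf': "integrable lebesgue (\<lambda>x. norm (deriv F (of_real x)) powr p * \<mu> x powr p)"
    using total by (intro integrableI_bounded) (auto simp: less_top[symmetric] top_unique)
  then show "(\<lambda>t. vector_derivative f (at t)) \<in> Lp_weighted p \<mu> \<inter> B_type \<sigma>"
    unfolding f' using F' by (auto simp: Lp_weighted_def B_type_def)
  have "(LINT x|lebesgue. norm (deriv F (of_real x)) powr p * \<mu> x powr p) \<le> J"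
    by (rule integral_real_bounded[OF J0 total])
  then have "Lp_weighted_norm p \<mu> (\<lambda>t. deriv F (of_real t)) \<le> J powr (1 / p)"
    unfolding Lp_weighted_norm_def using p by (intro powr_mono2 integral_nonneg_AE) auto
  also have "J powr (1 / p) = A * W * 2 powr ((p + 1) / p) * I powr (1 / p)"
    unfolding J_def using A0 W0 I0 p by (simp add: powr_mult powr_powr)
  also have "\<dots> = bernstein_const p * \<sigma> * Lp_weighted_norm p \<mu> f"
    by (simp add: bernstein_const_def Lp_weighted_norm_def I_def A_def W_def w_def mult_ac)
  finally show "Lp_weighted_norm p \<mu> (\<lambda>t. vector_derivative f (at t))
      \<le> bernstein_const p * \<sigma> * Lp_weighted_norm p \<mu> f"
    unfolding f' .
qed

lemma bernstein_nth_derivative: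
  assumes p: "1 \<le> p" and \<sigma>: "1 \<le> \<sigma>" and f: "f \<in> Lp_weighted p \<mu> \<inter> B_type \<sigma>"
  shows "nth_derivative n f \<in> Lp_weighted p \<mu> \<inter> B_type \<sigma> \<and>
    Lp_weighted_norm p \<mu> (nth_derivative n f) \<le> bernstein_const p ^ n * \<sigma> ^ n * Lp_weighted_norm p \<mu> f"
proof (induction n)
  case 0
  then show ?case using f by (simp add: nth_derivative_def)
next
  case (Suc n)
  have step: "nth_derivative (Suc n) f = (\<lambda>t. vector_derivative (nth_derivative n f) (at t))"
    by (simp add: nth_derivative_def)
  have "Lp_weighted_norm p \<mu> (nth_derivative (Suc n) f)
      \<le> bernstein_const p * \<sigma> * Lp_weighted_norm p \<mu> (nth_derivative n f)"
    unfolding step using Suc.IH by (intro bernstein_first_derivative(2)[OF p \<sigma>]) auto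
  also have "\<dots> \<le> bernstein_const p * \<sigma> * (bernstein_const p ^ n * \<sigma> ^ n * Lp_weighted_norm p \<mu> f)"
    using Suc.IH bernstein_const_pos[of p] \<sigma> by (intro mult_left_mono) auto
  finally show ?case
    using bernstein_first_derivative(1)[OF p \<sigma>, of "nth_derivative n f"] Suc.IH
    unfolding step[symmetric] by (simp add: mult_ac)
qed

end

theorem corollary4:
  fixes p :: real and \<mu> :: "real \<Rightarrow> real"
  assumes "1 \<le> p"
    and "\<And>t. 1 \<le> \<mu> t"
    and "\<And>t. \<mu> (- t) = \<mu> t"
    and "mono_on {0<..} \<mu>"
    and "\<And>s t. \<mu> (t + s) \<le> \<mu> t * \<mu> s"
    and "integrable lebesgue (\<lambda>t. ln (\<mu> t) / (1 + t\<^sup>2))"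
  shows "\<forall>n. \<exists>c>0. \<forall>\<sigma>\<ge>1. \<forall>f \<in> Lp_weighted p \<mu> \<inter> B_type \<sigma>.
    nth_derivative n f \<in> Lp_weighted p \<mu> \<and>
    Lp_weighted_norm p \<mu> (nth_derivative n f) \<le> c * \<sigma> ^ n * Lp_weighted_norm p \<mu> f"
proof
  fix n
  interpret submultiplicative_beurling_weight \<mu>
    by unfold_locales (use assms in auto)
  show "\<exists>c>0. \<forall>\<sigma>\<ge>1. \<forall>f \<in> Lp_weighted p \<mu> \<inter> B_type \<sigma>.
    nth_derivative n f \<in> Lp_weighted p \<mu> \<and>
    Lp_weighted_norm p \<mu> (nth_derivative n f) \<le> c * \<sigma> ^ n * Lp_weighted_norm p \<mu> f"
    using bernstein_nth_derivative[OF assms(1)] bernstein_const_pos[of p]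
    by (intro exI[of _ "bernstein_const p ^ n"]) auto
qed

end
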